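(* The function $g$ satisfies $g(n)=\Theta((\log n)^2)$; that is, there are constants $c,C>0$ and $n_0$ such that $c(\log n)^2\le g(n)\le C(\log n)^2$ for every integer $n\ge n_0$.
   Context: Here $[n]=\{1,\ldots,n\}$ and $\log$ is the natural logarithm. A strictly increasing sequence of integers $x_0<x_1<\cdots<x_m$ is an ascending wave if its consecutive differences are nondecreasing, i.e. $x_t-x_{t-1}\le x_{t+1}-x_t$ for all $1\le t<m$. Sequences of one or two terms are ascending waves by convention. The length of a finite sequence is its number of terms. For a positive integer $n$, $g(n)$ is the largest integer $k$ such that every set $A\subseteq[n]$ with $|A|\ge n/2$ contains an ascending wave of length $k$ (all of whose terms lie in $A$). *)

theory Defs
  imports Complex_Main
begin

text \<open>A finite integer sequence \<open>x\<^sub>0, \<dots>, x\<^sub>m\<close> is a nonempty list \<open>xs\<close> with \<open>xs ! t = x\<^sub>t\<close>; its number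
  of terms is \<open>length xs = m + 1\<close>, so the side condition \<open>1 \<le> t < m\<close> reads \<open>1 \<le> t\<close>,
  \<open>t + 1 < length xs\<close>.\<close>

definition ascending_wave :: "int list \<Rightarrow> bool" where
  "ascending_wave xs \<longleftrightarrow>
     xs \<noteq> [] \<and> sorted_wrt (<) xs \<and>
     (\<forall>t. 1 \<le> t \<and> t + 1 < length xs \<longrightarrow> xs ! t - xs ! (t - 1) \<le> xs ! (t + 1) - xs ! t)"

definition has_wave :: "int set \<Rightarrow> nat \<Rightarrow> bool" where
  "has_wave A k \<longleftrightarrow> (\<exists>xs. ascending_wave xs \<and> set xs \<subseteq> A \<and> length xs = k)"

text \<open>Meaningful for \<open>n \<ge> 1\<close> only: for \<open>n = 0\<close> no \<open>k\<close> qualifies and the value is unspecified.\<close>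

definition wave_g :: "nat \<Rightarrow> nat" where
  "wave_g n = (GREATEST k. \<forall>A \<subseteq> {1..int n}. real (card A) \<ge> real n / 2 \<longrightarrow> has_wave A k)"

text \<open>For \<open>n \<ge> 1\<close> the maximum exists, so \<open>GREATEST\<close> does denote it.\<close>

lemma has_wave_le_card:
  assumes "finite A" "has_wave A k"
  shows "k \<le> card A"
proof -
  obtain xs where "sorted_wrt (<) xs" "set xs \<subseteq> A" "length xs = k"
    using assms(2) unfolding has_wave_def ascending_wave_def by blast
  then show ?thesis
    using assms(1) by (metis card_mono distinct_card strict_sorted_iff)
qed

lemma wave_g_is_greatest:
  assumes "n \<ge> 1"
  shows "\<forall>A \<subseteq> {1..int n}. real (card A) \<ge> real n / 2 \<longrightarrow> has_wave A (wave_g n)"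
    and "(\<forall>A \<subseteq> {1..int n}. real (card A) \<ge> real n / 2 \<longrightarrow> has_wave A k) \<Longrightarrow> k \<le> wave_g n"
proof -
  let ?P = "\<lambda>k. \<forall>A \<subseteq> {1..int n}. real (card A) \<ge> real n / 2 \<longrightarrow> has_wave A k"
  have bound: "k \<le> n" if "?P k" for k
  proof -
    have "has_wave {1..int n} k" using that by simp
    then show ?thesis using has_wave_le_card[of "{1..int n}" k] by simp
  qed
  have one: "?P 1"
  proof (intro allI impI)
    fix A :: "int set"
    assume "A \<subseteq> {1..int n}" "real (card A) \<ge> real n / 2"
    then have "A \<noteq> {}" using assms by auto
    then obtain a where "a \<in> A" by blast
    then have "ascending_wave [a] \<and> set [a] \<subseteq> A \<and> length [a] = 1"
      by (simp add: ascending_wave_def)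
    then show "has_wave A 1" unfolding has_wave_def by blast
  qed
  show "?P (wave_g n)"
    unfolding wave_g_def by (rule GreatestI_nat[of ?P, OF one bound])
  show "?P k \<Longrightarrow> k \<le> wave_g n"
    unfolding wave_g_def by (rule Greatest_le_nat[of ?P, OF _ bound])
qed

end

theory Submission
  imports Defs
begin

text \<open>
  Upper bound. Let \<open>M\<close> be about \<open>log\<^sub>2 n\<close>. For every scale \<open>i \<le> M\<close> punch holes of length \<open>2^i\<close>
  into \<open>[n]\<close>, periodically, with period \<open>2 (M + 1) 2^i\<close>. Each scale removes a fraction
  \<open>1 / (2 (M + 1))\<close>, so at least half of \<open>[n]\<close> remains. While the gaps of a wave lie in
  \<open>(2^(i-1), 2^i]\<close>, the wave cannot jump over a hole of scale \<open>i\<close>, hence stays in one period and makes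
  only \<open>O(M)\<close> steps. There are \<open>M + 1\<close> scales, which gives \<open>O(M\<^sup>2)\<close> terms (\<open>wave_in_pitted\<close>).

  Lower bound. One shows that for most scales \<open>D = 4^i\<close> a wave can make of the order of
  \<open>K = \<epsilon> log n\<close> steps with gaps in \<open>[D, 2D]\<close>, and that these pieces can be joined. A step of length
  about \<open>D\<close> meets a hole of length \<open>h \<le> D\<close> with probability about \<open>h/D\<close> times the number of such
  holes per length \<open>D\<close>, and then has to grow by up to \<open>h\<close>; so the relevant damage
  of a hole at scale \<open>D\<close> is \<open>min(h, D)\<^sup>2\<close>, compared with \<open>D\<^sup>2\<close>. Since
  \<open>\<Sum>\<^sub>D min(h, D)\<^sup>2 / D = O(h)\<close> over the powers of 4, the damage at all scales within distance
  \<open>O(K D)\<close> of a random point of \<open>A\<close> sums to \<open>O(K)\<close> in the mean, so some point \<open>o\<close> sees little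
  damage at most of the scales (\<open>good_origin\<close>).

  Adversarial sets may be built so that a greedily chosen wave meets a hole at every step. The
  heuristic count is therefore made rigorous not for one wave but for all of them together. Fix the start \<open>x\<close> and a scale
  \<open>D\<close>, and let \<open>reach t u\<close> be the set of positions reachable by \<open>t\<close> steps whose gaps are at least
  \<open>D\<close>, nondecreasing and at most \<open>u\<close>. Shifting by \<open>u\<close> maps \<open>reach t u\<close> into \<open>reach (t+1) u\<close> except at
  points inside holes, and if such a point has its hole's end at distance \<open>r\<close>, the shift fails
  for at most \<open>2r\<close> values of \<open>u\<close>. Summed over \<open>u\<close>, one step thus loses at most
  \<open>\<Sum> 2r = O(\<Sum> h\<^sup>2)\<close>. On the other hand the leftmost reachable position, the front, moves by some
  \<open>g\<close>, and the strip of length \<open>u - g\<close> behind the shifted set becomes reachable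
  (\<open>card_reach_step\<close>). Comparing the number of points gained with the trivial
  upper bound \<open>x + T u - front + 1\<close> for the size of \<open>reach T u\<close> shows that
  the front moves with mean speed at most \<open>5/4 D\<close> (\<open>front_bound\<close>), and then that the reachable set does not die out
  for \<open>K\<close> steps (\<open>reach_alive\<close>). The speed of the front is controlled through doublings of \<open>T\<close>,
  each costing the square root of the damage within distance \<open>O(T D)\<close> of \<open>x\<close>; these have to be
  summable, which is why damage close to the start is weighted more heavily (\<open>weighted_cost\<close>,
  \<open>clean\<close>). A start that is clean for the next good scale is found by averaging in the region that
  the wave of the present scale runs through (\<open>next_stage\<close>).
\<close>

section \<open>A dense set with only short waves\<close>

text \<open>For every scale \<open>i\<close>, the point \<open>x\<close> must not lie in the last of the \<open>2 (M + 1)\<close> blocks of length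
  \<open>2^i\<close> of its period. Putting the hole at the end of the period makes the bound on the number
  of removed points exact also for an incomplete last period.\<close>
definition pitted :: "nat \<Rightarrow> nat \<Rightarrow> int set" where
  "pitted n M = {x \<in> {1..int n}. \<forall>i\<le>M. ((x - 1) div 2^i) mod (2 * (int M + 1)) \<noteq> 2 * int M + 1}"

text \<open>The translates of the set of holes to the left by \<open>0, q, \<dots>, (P - 1) q\<close> are disjoint and stay
  inside \<open>[n]\<close>.\<close>
lemma card_pits:
  fixes P q :: int
  assumes "P \<ge> 1" "q \<ge> 1"
  shows "P * int (card {x \<in> {1..int n}. ((x - 1) div q) mod P = P - 1}) \<le> int n"
proof -
  let ?H = "{x \<in> {1..int n}. ((x - 1) div q) mod P = P - 1}"
  let ?f = "\<lambda>(k, x). x - k * q"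
  have dv: "(x - k * q - 1) div q = (x - 1) div q - k" for x k :: int
  proof -
    have "(x - 1 + (- k) * q) div q = - k + (x - 1) div q" using assms(2) by (intro div_mult_self1) auto
    then show ?thesis by (simp add: algebra_simps)
  qed
  have md: "((x - k * q - 1) div q) mod P = P - 1 - k" if "k \<in> {0..<P}" "x \<in> ?H" for x k
  proof -
    have "((x - k * q - 1) div q) mod P = (((x - 1) div q) mod P - k) mod P"
      by (simp add: dv mod_diff_left_eq)
    also have "\<dots> = (P - 1 - k) mod P" using that by simp
    also have "\<dots> = P - 1 - k" using that by (intro mod_pos_pos_trivial) auto
    finally show ?thesis .
  qed
  have inj: "inj_on ?f ({0..<P} \<times> ?H)"
  proof (rule inj_onI, clarify)
    fix k x k' x'
    assume a: "k \<in> {0..<P}" "k' \<in> {0..<P}" "x - k * q = x' - k' * q"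
      "x \<in> {1..int n}" "((x - 1) div q) mod P = P - 1" "x' \<in> {1..int n}" "((x' - 1) div q) mod P = P - 1"
    have "P - 1 - k = P - 1 - k'" using md[of k x] md[of k' x'] a by simp
    then show "k = k' \<and> x = x'" using a(3) by simp
  qed
  have img: "?f ` ({0..<P} \<times> ?H) \<subseteq> {1..int n}"
  proof clarify
    fix k x assume a: "k \<in> {0..<P}" "x \<in> {1..int n}" "((x - 1) div q) mod P = P - 1"
    have "0 \<le> (x - 1) div q" using a assms by (simp add: pos_imp_zdiv_nonneg_iff)
    then have "P - 1 \<le> (x - 1) div q" using a(3) zmod_le_nonneg_dividend by metis
    then have "k \<le> (x - 1) div q" using a by simp
    then have "k * q \<le> (x - 1) div q * q" using assms by (intro mult_right_mono) auto
    also have "\<dots> \<le> x - 1" using assms div_mult_mod_eq[of "x - 1" q] pos_mod_sign[of q "x - 1"] by linarith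
    finally have "k * q \<le> x - 1" .
    moreover have "0 \<le> k * q" using a assms by simp
    ultimately show "x - k * q \<in> {1..int n}" using a by simp
  qed
  have "card ({0..<P} \<times> ?H) \<le> card {1..int n}"
    using card_inj_on_le[OF inj img] by simp
  then have "nat P * card ?H \<le> n" by (simp add: card_cartesian_product)
  then have "int (nat P * card ?H) \<le> int n" by presburger
  then show ?thesis using assms by simp
qed

lemma card_pitted: "real (card (pitted n M)) \<ge> real n / 2"
proof -
  let ?P = "2 * (int M + 1)"
  let ?H = "\<lambda>i. {x \<in> {1..int n}. ((x - 1) div 2^i) mod ?P = ?P - 1}"
  have eq: "{1..int n} - pitted n M = (\<Union>i\<in>{..M}. ?H i)"
    by (auto simp: pitted_def)
  have each: "real (card (?H i)) \<le> real n / (2 * (real M + 1))" for i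
  proof -
    have "?P * int (card (?H i)) \<le> int n" by (rule card_pits) auto
    then have "real_of_int (?P * int (card (?H i))) \<le> real_of_int (int n)" by (simp only: of_int_le_iff)
    then show ?thesis by (simp add: field_simps)
  qed
  have "card ({1..int n} - pitted n M) \<le> (\<Sum>i\<in>{..M}. card (?H i))"
    unfolding eq by (rule card_UN_le) simp
  then have "real (card ({1..int n} - pitted n M)) \<le> (\<Sum>i\<in>{..M}. real (card (?H i)))"
    by (simp only: of_nat_sum[symmetric] of_nat_le_iff)
  also have "\<dots> \<le> (\<Sum>i\<in>{..M}. real n / (2 * (real M + 1)))" by (intro sum_mono each)
  also have "\<dots> = real n / 2" by (simp add: field_simps)
  finally have "real (card ({1..int n} - pitted n M)) \<le> real n / 2" .
  moreover have "pitted n M \<subseteq> {1..int n}" by (auto simp: pitted_def)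
  then have "card ({1..int n} - pitted n M) = n - card (pitted n M)" "card (pitted n M) \<le> n"
    by (auto simp: card_Diff_subset finite_subset dest: card_mono[rotated])
  ultimately show ?thesis by (simp add: of_nat_diff field_simps)
qed

text \<open>Two points outside the holes that are at most one hole length apart lie in the same period,
  because leaving a period means jumping over the hole at its end.\<close>
lemma small_step_same_block:
  fixes x y q P :: int
  assumes "q \<ge> 1" "P \<ge> 1" "((x - 1) div q) mod P \<noteq> P - 1" "((y - 1) div q) mod P \<noteq> P - 1" "x \<le> y" "y \<le> x + q"
  shows "((x - 1) div q) div P = ((y - 1) div q) div P"
proof -
  let ?a = "(x - 1) div q" and ?b = "(y - 1) div q"
  have "?a \<le> ?b" using assms by (intro zdiv_mono1) auto
  moreover have "?b \<le> (x - 1 + 1 * q) div q" using assms by (intro zdiv_mono1) auto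
  then have "?b \<le> ?a + 1" using assms by simp
  ultimately consider "?b = ?a" | "?b = ?a + 1" by linarith
  then show ?thesis
  proof cases
    case 2
    have m: "?a mod P < P - 1" using assms by (smt (verit) pos_mod_bound)
    have "(?a + 1) div P = ?a div P"
    proof -
      have "?a + 1 = (?a mod P + 1) + P * (?a div P)" by simp
      then have "(?a + 1) div P = (?a mod P + 1) div P + ?a div P"
        using assms by (metis add.commute div_mult_self2 mult.commute not_one_le_zero)
      moreover have "(?a mod P + 1) div P = 0" using m assms by (intro div_pos_pos_trivial) auto
      ultimately show ?thesis by simp
    qed
    then show ?thesis using 2 by simp
  qed simp
qed

lemma ascending_wave_gap_mono:
  assumes "ascending_wave xs" "s \<le> t" "t + 1 < length xs"
  shows "xs ! (s+1) - xs ! s \<le> xs ! (t+1) - xs ! t"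
  using assms(2,3)
proof (induction t rule: dec_induct)
  case (step t)
  have "xs ! (t+1) - xs ! t \<le> xs ! (t+1+1) - xs ! (t+1)"
    using assms(1) step.prems unfolding ascending_wave_def
    by (elim conjE allE[of _ "t+1"]) simp
  then show ?case using step by simp
qed simp

lemma ascending_wave_gap_pos:
  assumes "ascending_wave xs" "t + 1 < length xs"
  shows "xs ! t < xs ! (t+1)"
  using assms unfolding ascending_wave_def by (simp add: sorted_wrt_nth_less)

lemma double_div_bounds:
  fixes x q :: int
  assumes "0 < q"
  shows "2 * (x div q) \<le> (2 * x) div q \<and> (2 * x) div q < 2 * (x div q) + 2"
proof -
  have "(2 * x) div q = (2 * (x mod q) + (2 * (x div q)) * q) div q"
    by (metis add.commute distrib_left mult.assoc mult.commute mult_div_mod_eq)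
  also have "\<dots> = 2 * (x div q) + (2 * (x mod q)) div q" using assms by (intro div_mult_self1) auto
  finally have "(2 * x) div q = 2 * (x div q) + (2 * (x mod q)) div q" .
  moreover have "0 \<le> (2 * (x mod q)) div q" using assms by (simp add: pos_imp_zdiv_nonneg_iff)
  moreover have "(2 * (x mod q)) div q < 2" 
  proof -
    have "2 * (x mod q) < 2 * q" using assms pos_mod_bound[of q x] by linarith
    moreover have "(2 * (x mod q)) div q * q \<le> 2 * (x mod q)"
      using div_mult_mod_eq[of "2 * (x mod q)" q] pos_mod_sign[OF assms, of "2 * (x mod q)"] by linarith
    ultimately have "(2 * (x mod q)) div q * q < 2 * q" by (rule le_less_trans[rotated])
    then show ?thesis using assms by (simp only: mult_less_cancel_right_pos)
  qed
  ultimately show ?thesis by linarith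
qed

text \<open>Gaps are nondecreasing, so those of one scale are consecutive and all their left endpoints lie in
  one period. On them \<open>t \<mapsto> \<lfloor>2 (x\<^sub>t - 1) / 2^i\<rfloor>\<close> is strictly increasing, as every gap exceeds
  \<open>2^i / 2\<close>, and it takes at most \<open>2P\<close> values on a period.\<close>
lemma gaps_per_scale:
  fixes P :: int
  assumes "ascending_wave xs" "P \<ge> 1" "\<And>x. x \<in> set xs \<Longrightarrow> ((x - 1) div 2^i) mod P \<noteq> P - 1"
  shows "card {t. t + 1 < length xs \<and> 2^i < 2 * (xs ! (t+1) - xs ! t) \<and> xs ! (t+1) - xs ! t \<le> 2^i} \<le> nat (2 * P)"
proof (cases "{t. t + 1 < length xs \<and> 2^i < 2 * (xs ! (t+1) - xs ! t) \<and> xs ! (t+1) - xs ! t \<le> 2^i} = {}")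
  case False
  let ?q = "2^i :: int"
  let ?T = "{t. t + 1 < length xs \<and> ?q < 2 * (xs ! (t+1) - xs ! t) \<and> xs ! (t+1) - xs ! t \<le> ?q}"
  have fin: "finite ?T" by (rule finite_subset[of _ "{..<length xs}"]) auto
  define a where "a = Min ?T"
  have aT: "a \<in> ?T" unfolding a_def using fin False by (rule Min_in)
  have amin: "a \<le> t" if "t \<in> ?T" for t unfolding a_def using fin that by (rule Min_le)
  define b where "b = ((xs ! a - 1) div ?q) div P"
  have block: "((xs ! t - 1) div ?q) div P = b" if "a \<le> t" "t \<in> ?T" for t
    using that
  proof (induction t rule: dec_induct)
    case base then show ?case by (simp add: b_def)
  next
    case (step t)
    have g: "xs ! (t+1) - xs ! t \<le> xs ! (t+1+1) - xs ! (t+1)"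
      using ascending_wave_gap_mono[OF assms(1), of t "t+1"] step.prems by simp
    have g2: "xs ! (a+1) - xs ! a \<le> xs ! (t+1) - xs ! t"
      using ascending_wave_gap_mono[OF assms(1), of a t] step by simp
    have tT: "t \<in> ?T" using step.prems g g2 aT by auto
    have "((xs ! t - 1) div ?q) div P = ((xs ! (t+1) - 1) div ?q) div P"
    proof (rule small_step_same_block)
      show "((xs ! t - 1) div ?q) mod P \<noteq> P - 1" "((xs ! (t+1) - 1) div ?q) mod P \<noteq> P - 1"
        using assms(3) step.prems by auto
      show "xs ! t \<le> xs ! (t+1)" using ascending_wave_gap_pos[OF assms(1), of t] step.prems by simp
      show "xs ! (t+1) \<le> xs ! t + ?q" using tT by simp
    qed (use assms in auto)
    then show ?case using step.IH[OF tT] by simp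
  qed
  let ?f = "\<lambda>t. (2 * (xs ! t - 1)) div ?q"
  have less: "?f s < ?f t" if "s < t" "s \<in> ?T" "t \<in> ?T" for s t
  proof -
    have "xs ! (s+1) \<le> xs ! t"
    proof (cases "s + 1 = t")
      case False
      then have "s + 1 < t" using that by simp
      moreover have "t < length xs" using that by simp
      ultimately have "xs ! (s+1) < xs ! t"
        using assms(1) unfolding ascending_wave_def by (intro sorted_wrt_nth_less) auto
      then show ?thesis by simp
    qed simp
    then have "2 * (xs ! s - 1) + 1 * ?q \<le> 2 * (xs ! t - 1)" using that by auto
    then have "(2 * (xs ! s - 1) + 1 * ?q) div ?q \<le> ?f t" by (intro zdiv_mono1) auto
    then show ?thesis by simp
  qed
  have inj: "inj_on ?f ?T"
  proof (rule inj_onI)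
    fix s t assume st: "s \<in> ?T" "t \<in> ?T" "?f s = ?f t"
    show "s = t"
    proof (rule linorder_cases[of s t])
      assume "s < t" then show ?thesis using less[OF _ st(1,2)] st(3) by simp
    next
      assume "t < s" then show ?thesis using less[OF _ st(2,1)] st(3) by simp
    qed
  qed
  have img: "?f ` ?T \<subseteq> {2 * P * b..<2 * P * b + 2 * P}"
  proof
    fix y assume "y \<in> ?f ` ?T"
    then obtain t where t: "t \<in> ?T" "y = ?f t" by blast
    let ?c = "(xs ! t - 1) div ?q"
    have c: "P * b \<le> ?c" "?c < P * b + P"
    proof -
      have "?c = P * b + ?c mod P" using block[OF amin[OF t(1)] t(1)] by (metis mult_div_mod_eq)
      moreover have "0 \<le> ?c mod P" "?c mod P < P" using assms(2) by auto
      ultimately show "P * b \<le> ?c" "?c < P * b + P" by linarith+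
    qed
    have y: "2 * ?c \<le> y" "y < 2 * ?c + 2"
      unfolding t(2) using double_div_bounds[of ?q "xs ! t - 1"] by auto
    have e: "2 * P * b = 2 * (P * b)" by simp
    show "y \<in> {2 * P * b..<2 * P * b + 2 * P}" unfolding e using c y by auto
  qed
  have "card ?T \<le> card {2 * P * b..<2 * P * b + 2 * P}"
    using card_inj_on_le[OF inj img] by simp
  then show ?thesis by simp
next
  case True
  show ?thesis unfolding True by simp
qed

lemma wave_in_pitted:
  assumes "n \<le> 2^M" "has_wave (pitted n M) k"
  shows "k \<le> 1 + (M + 1) * (4 * (M + 1))"
proof -
  obtain xs where xs: "ascending_wave xs" "set xs \<subseteq> pitted n M" "length xs = k"
    using assms(2) unfolding has_wave_def by blast
  let ?P = "2 * (int M + 1)"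
  let ?T = "\<lambda>i. {t. t + 1 < length xs \<and> 2^i < 2 * (xs ! (t+1) - xs ! t) \<and> xs ! (t+1) - xs ! t \<le> 2^i}"
  have "card (?T i) \<le> 4 * (M + 1)" if "i \<le> M" for i
  proof -
    have "card (?T i) \<le> nat (2 * ?P)"
      by (rule gaps_per_scale[OF xs(1)]) (use xs(2) that in \<open>fastforce simp: pitted_def\<close>)+
    then show ?thesis by (simp add: nat_mult_distrib)
  qed
  note each = this
  have cover: "{..<k - 1} \<subseteq> (\<Union>i\<in>{..M}. ?T i)"
  proof
    fix t assume "t \<in> {..<k - 1}"
    then have t: "t + 1 < length xs" using xs(3) by simp
    define d where "d = xs ! (t+1) - xs ! t"
    have d1: "1 \<le> d" unfolding d_def using ascending_wave_gap_pos[OF xs(1) t] by simp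
    have "xs ! (t+1) \<in> {1..int n}" "xs ! t \<in> {1..int n}"
      using subsetD[OF xs(2) nth_mem[of "t+1"]] subsetD[OF xs(2) nth_mem[of t]] t by (auto simp: pitted_def)
    then have "d \<le> int n" unfolding d_def by simp
    also have "\<dots> \<le> 2^M" using assms(1) by (metis of_nat_le_iff of_nat_numeral of_nat_power)
    finally have dM: "d \<le> 2^M" .
    define i where "i = (LEAST i. d \<le> 2^i)"
    have i1: "d \<le> 2^i" unfolding i_def using dM by (rule LeastI)
    have i2: "i \<le> M" unfolding i_def using dM by (rule Least_le)
    have "2^i < 2 * d"
    proof (cases i)
      case (Suc j)
      then have "\<not> d \<le> 2^j" unfolding i_def by (metis lessI not_less_Least)
      then show ?thesis using Suc by simp
    qed (use d1 in simp)
    then show "t \<in> (\<Union>i\<in>{..M}. ?T i)" using i1 i2 t unfolding d_def by blast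
  qed
  have fin: "finite (?T i)" for i by (rule finite_subset[of _ "{..<length xs}"]) auto
  have "k - 1 \<le> card (\<Union>i\<in>{..M}. ?T i)"
    using card_mono[OF _ cover] fin by simp
  also have "\<dots> \<le> (\<Sum>i\<in>{..M}. card (?T i))" by (rule card_UN_le) simp
  also have "\<dots> \<le> (\<Sum>i\<in>{..M}. 4 * (M + 1))" by (rule sum_mono) (use each in auto)
  also have "\<dots> = (M + 1) * (4 * (M + 1))" by simp
  finally show ?thesis by simp
qed

lemma wave_g_upper:
  assumes "n \<ge> 2"
  shows "real (wave_g n) \<le> 65 / (ln 2)\<^sup>2 * (ln (real n))\<^sup>2"
proof -
  \<comment> \<open>The least \<open>M\<close> with \<open>n \<le> 2^M\<close>, so that every gap has a scale \<open>i \<le> M\<close>.\<close>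
  define M where "M = nat \<lceil>log 2 (real n)\<rceil>"
  have lg: "1 \<le> log 2 (real n)" using assms by simp
  have M: "log 2 (real n) \<le> real M" "real M \<le> log 2 (real n) + 1"
    unfolding M_def using lg by linarith+
  have "real n = 2 powr (log 2 (real n))" using assms by simp
  also have "\<dots> \<le> 2 powr (real M)" using M by (intro powr_mono) auto
  also have "\<dots> = real (2^M)" by (simp add: powr_realpow)
  finally have nM: "n \<le> 2^M" by (simp only: of_nat_le_iff)
  have "has_wave (pitted n M) (wave_g n)"
  proof -
    have "1 \<le> n" using assms by simp
    moreover have "pitted n M \<subseteq> {1..int n}" by (auto simp: pitted_def)
    ultimately show ?thesis using wave_g_is_greatest(1)[of n] card_pitted[of n M] by blast
  qed
  then have "wave_g n \<le> 1 + (M + 1) * (4 * (M + 1))" using wave_in_pitted[OF nM] by simp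
  then have "real (wave_g n) \<le> real (1 + (M + 1) * (4 * (M + 1)))" by (simp only: of_nat_le_iff)
  also have "\<dots> = 1 + 4 * (real M + 1)\<^sup>2" by (simp add: power2_eq_square algebra_simps)
  also have "\<dots> \<le> (log 2 (real n))\<^sup>2 + 4 * (4 * log 2 (real n))\<^sup>2"
  proof -
    have "(real M + 1)\<^sup>2 \<le> (4 * log 2 (real n))\<^sup>2" using M lg by (intro power_mono) auto
    moreover have "1 \<le> (log 2 (real n))\<^sup>2" using lg by simp
    ultimately show ?thesis by simp
  qed
  also have "\<dots> = 65 / (ln 2)\<^sup>2 * (ln (real n))\<^sup>2"
    by (simp add: log_def power_divide power_mult_distrib)
  finally show ?thesis .
qed

section \<open>Level sets of reachable positions\<close>

text \<open>Membership in \<open>A\<close> is required of every point except the last one. Thus a level set can be compared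
  with its translate even where the translate falls into a hole; the price for a point in a hole
  is paid one step later. Gaps are bounded below by \<open>D\<close> through the value at \<open>t = 0\<close>.\<close>
fun reach :: "int set \<Rightarrow> int \<Rightarrow> int \<Rightarrow> nat \<Rightarrow> int \<Rightarrow> int set" where
  "reach A D x 0 u = (if D \<le> u then {x} else {})"
| "reach A D x (Suc t) u = {y. \<exists>g. D \<le> g \<and> g \<le> u \<and> y - g \<in> A \<and> y - g \<in> reach A D x t g}"

declare reach.simps(2)[simp del]

lemma reach_SucE:
  assumes "y \<in> reach A D x (Suc t) u"
  obtains g where "D \<le> g" "g \<le> u" "y - g \<in> A" "y - g \<in> reach A D x t g"
  using assms by (auto simp: reach.simps(2))

lemma reach_SucI: "D \<le> g \<Longrightarrow> g \<le> u \<Longrightarrow> y - g \<in> A \<Longrightarrow> y - g \<in> reach A D x t g \<Longrightarrow> y \<in> reach A D x (Suc t) u"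
  by (auto simp: reach.simps(2))

lemma reach_mono: "y \<in> reach A D x t u \<Longrightarrow> u \<le> v \<Longrightarrow> y \<in> reach A D x t v"
  by (cases t) (auto split: if_splits elim!: reach_SucE intro: reach_SucI)

lemma reach_ge: "y \<in> reach A D x t u \<Longrightarrow> D \<le> u"
  by (cases t) (auto split: if_splits elim!: reach_SucE)

lemma reach_bounds: "y \<in> reach A D x t u \<Longrightarrow> x + int t * D \<le> y \<and> y \<le> x + int t * u"
proof (induction t arbitrary: y u)
  case (Suc t)
  then obtain g where g: "D \<le> g" "g \<le> u" "y - g \<in> reach A D x t g" by (blast elim: reach_SucE)
  have "x + int t * D \<le> y - g" "y - g \<le> x + int t * g" using Suc.IH[OF g(3)] by auto
  moreover have "int t * g \<le> int t * u" using g by (intro mult_left_mono) auto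
  ultimately show ?case using g by (simp add: algebra_simps)
qed (auto split: if_splits)

lemma finite_reach: "finite (reach A D x t u)"
  by (rule finite_subset[of _ "{x + int t * D..x + int t * u}"]) (use reach_bounds in auto)

text \<open>Only the last gap has to grow. For \<open>t = 0\<close> this would fail, since there is no gap.\<close>
lemma reach_shift: "y \<in> reach A D x (Suc t) u \<Longrightarrow> 0 \<le> k \<Longrightarrow> y + k \<in> reach A D x (Suc t) (u + k)"
proof -
  assume a: "y \<in> reach A D x (Suc t) u" "0 \<le> k"
  then obtain g where g: "D \<le> g" "g \<le> u" "y - g \<in> A" "y - g \<in> reach A D x t g" by (blast elim: reach_SucE)
  have "y - g \<in> reach A D x t (g + k)" using reach_mono[OF g(4)] a by simp
  then show ?thesis using g a by (intro reach_SucI[of _ "g + k"]) auto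
qed

lemma reach_step: "y \<in> A \<Longrightarrow> y \<in> reach A D x t g \<Longrightarrow> g \<le> u \<Longrightarrow> y + g \<in> reach A D x (Suc t) u"
  using reach_ge by (intro reach_SucI[of _ g]) auto

lemma reach_pred_nonempty: "reach A D x (Suc t) u \<noteq> {} \<Longrightarrow> reach A D x t u \<noteq> {}"
  by (blast elim: reach_SucE intro: reach_mono)

lemma reach_nonempty_le: "s \<le> t \<Longrightarrow> reach A D x t u \<noteq> {} \<Longrightarrow> reach A D x s u \<noteq> {}"
proof (induction t rule: dec_induct)
  case (step t) then show ?case using reach_pred_nonempty by blast
qed

text \<open>The bound \<open>2 * D\<close> makes one front serve all levels \<open>u \<le> 2 * D\<close> at once. As \<open>reach\<close> does not
  restrict its last point, the front may lie in a hole.\<close>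
definition front :: "int set \<Rightarrow> int \<Rightarrow> int \<Rightarrow> nat \<Rightarrow> int" where
  "front A D x t = Min (reach A D x t (2 * D))"

lemma front_in: "reach A D x t (2*D) \<noteq> {} \<Longrightarrow> front A D x t \<in> reach A D x t (2*D)"
  unfolding front_def using finite_reach by (rule Min_in)

lemma front_le: "y \<in> reach A D x t u \<Longrightarrow> u \<le> 2*D \<Longrightarrow> front A D x t \<le> y"
  unfolding front_def using finite_reach by (intro Min_le) (auto intro: reach_mono)

text \<open>Distances are measured so that they vanish exactly on \<open>A\<close>; they are meaningful only where \<open>A\<close> has a
  point on the side in question.\<close>
definition prev_dist :: "int set \<Rightarrow> int \<Rightarrow> nat" where
  "prev_dist A z = (LEAST k. z - int k \<in> A)"

definition next_dist :: "int set \<Rightarrow> int \<Rightarrow> nat" where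
  "next_dist A y = (LEAST k. y + int k \<in> A)"

text \<open>The points \<open>y\<close> at which \<open>y + u \<in> reach (t+1) u\<close> may fail. For \<open>y\<close> in a hole ending at
  \<open>e = y + r\<close> one can first go to \<open>e\<close>, which raises the gap by \<open>r\<close>, and then make a step of length
  \<open>u - r\<close> from \<open>e\<close> to \<open>y + u\<close>; this is a wave as soon as \<open>y\<close> is reachable with last gap \<open>\<le> u - 2r\<close>.\<close>
definition lost :: "int set \<Rightarrow> int \<Rightarrow> int \<Rightarrow> nat \<Rightarrow> int \<Rightarrow> int set" where
  "lost A D x t u = {y \<in> reach A D x t u. y \<notin> A \<and> y \<notin> reach A D x t (u - 2 * int (next_dist A y))}"

lemma next_dist_in: "e \<in> A \<Longrightarrow> y \<le> e \<Longrightarrow> y + int (next_dist A y) \<in> A"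
  unfolding next_dist_def by (rule LeastI[of _ "nat (e - y)"]) simp

lemma next_dist_le: "e \<in> A \<Longrightarrow> y \<le> e \<Longrightarrow> y + int (next_dist A y) \<le> e"
proof -
  assume "e \<in> A" "y \<le> e"
  then have "next_dist A y \<le> nat (e - y)" unfolding next_dist_def by (intro Least_le) simp
  then show ?thesis using \<open>y \<le> e\<close> by linarith
qed

lemma next_dist_notin: "k < next_dist A y \<Longrightarrow> y + int k \<notin> A"
  unfolding next_dist_def by (rule not_less_Least)

lemma prev_dist_in: "e \<in> A \<Longrightarrow> e \<le> z \<Longrightarrow> z - int (prev_dist A z) \<in> A"
  unfolding prev_dist_def by (rule LeastI[of _ "nat (z - e)"]) simp

lemma prev_dist_le: "e \<in> A \<Longrightarrow> e \<le> z \<Longrightarrow> int (prev_dist A z) \<le> z - e"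
proof -
  assume "e \<in> A" "e \<le> z"
  then have "prev_dist A z \<le> nat (z - e)" unfolding prev_dist_def by (intro Least_le) simp
  then show ?thesis using \<open>e \<le> z\<close> by linarith
qed

lemma prev_dist_notin: "k < prev_dist A z \<Longrightarrow> z - int k \<notin> A"
  unfolding prev_dist_def by (rule not_less_Least)

text \<open>The points that are not lost, translated by \<open>u\<close>, lie to the right of \<open>front t + u\<close>. The strip from the new front to
  \<open>front t + u\<close> is reached as well: the predecessor of the new front is not left of the old
  front, so it reaches the whole strip by enlarging its last gap.\<close>
lemma card_reach_step:
  assumes x: "x \<in> A" and D: "0 \<le> D"
    and next_ex: "\<And>y. y \<in> reach A D x t u \<Longrightarrow> \<exists>e\<in>A. y \<le> e"
    and ne: "reach A D x (Suc t) (2*D) \<noteq> {}" and u: "D \<le> u" "u \<le> 2*D"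
  shows "int (card (reach A D x t u)) + max 0 (u - (front A D x (Suc t) - front A D x t))
     \<le> int (card (reach A D x (Suc t) u)) + int (card (lost A D x t u))"
proof -
  let ?R = "reach A D x t u" and ?R' = "reach A D x (Suc t) u" and ?L = "lost A D x t u"
  let ?a = "front A D x t" and ?a' = "front A D x (Suc t)"
  let ?I = "(\<lambda>y. y + u) ` (?R - ?L)"
  let ?S = "{?a'..<?a + u}"
  have LR: "?L \<subseteq> ?R" by (auto simp: lost_def)
  have I: "?I \<subseteq> ?R'"
  proof
    fix w assume "w \<in> ?I"
    then obtain y where y: "y \<in> ?R" "y \<notin> ?L" "w = y + u" by blast
    show "w \<in> ?R'"
    proof (cases "y \<in> A")
      case True
      then show ?thesis unfolding y(3) using y(1) by (intro reach_step) auto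
    next
      case False
      let ?r = "int (next_dist A y)"
      from False have y2: "y \<in> reach A D x t (u - 2 * ?r)" using y by (auto simp: lost_def)
      obtain t' where t': "t = Suc t'"
        using False y(1) x by (cases t) (auto split: if_splits)
      have e: "y + ?r \<in> A" using next_ex[OF y(1)] next_dist_in by blast
      have "y + ?r \<in> reach A D x t (u - 2 * ?r + ?r)"
        unfolding t' using y2 unfolding t' by (intro reach_shift) auto
      then have "y + ?r + (u - ?r) \<in> ?R'" using e by (intro reach_step) auto
      then show ?thesis unfolding y(3) by simp
    qed
  qed
  have S: "?S \<subseteq> ?R'"
  proof
    fix w assume w: "w \<in> ?S"
    from front_in[OF ne] obtain g where g: "D \<le> g" "g \<le> 2*D" "?a' - g \<in> A" "?a' - g \<in> reach A D x t g"
      by (blast elim: reach_SucE)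
    have z: "?a \<le> ?a' - g" using front_le[OF g(4) g(2)] .
    let ?g = "w - (?a' - g)"
    have "?a' - g \<in> reach A D x t ?g" using reach_mono[OF g(4)] w by simp
    then have "(?a' - g) + ?g \<in> ?R'" using g w z by (intro reach_step) auto
    then show "w \<in> ?R'" by simp
  qed
  have disj: "?I \<inter> ?S = {}" using front_le[OF _ u(2)] by fastforce
  have fin: "finite ?I" "finite ?S" using finite_reach by auto
  have "card ?I + card ?S = card (?I \<union> ?S)" using fin disj by (simp add: card_Un_disjoint)
  also have "\<dots> \<le> card ?R'" using I S finite_reach[of A D x "Suc t" u] by (intro card_mono) auto
  finally have "card ?I + card ?S \<le> card ?R'" .
  moreover have "card ?I = card (?R - ?L)" by (rule card_image) (auto simp: inj_on_def)
  moreover have "card (?R - ?L) = card ?R - card ?L" using LR finite_reach by (metis card_Diff_subset finite_subset)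
  moreover have "card ?L \<le> card ?R" using LR finite_reach by (metis card_mono)
  ultimately show ?thesis by simp
qed

lemma card_reach_lower:
  assumes x: "x \<in> A" and D: "0 \<le> D"
    and next_ex: "\<And>t y. t < T \<Longrightarrow> y \<in> reach A D x t u \<Longrightarrow> \<exists>e\<in>A. y \<le> e"
    and ne: "reach A D x T (2*D) \<noteq> {}" and u: "D \<le> u" "u \<le> 2*D"
  shows "1 + (\<Sum>t<T. max 0 (u - (front A D x (Suc t) - front A D x t)))
     \<le> int (card (reach A D x T u)) + (\<Sum>t<T. int (card (lost A D x t u)))"
  using next_ex ne
proof (induction T)
  case 0 then show ?case using u by simp
next
  case (Suc T)
  have "1 + (\<Sum>t<T. max 0 (u - (front A D x (Suc t) - front A D x t)))
     \<le> int (card (reach A D x T u)) + (\<Sum>t<T. int (card (lost A D x t u)))"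
  proof (rule Suc.IH)
    show "\<exists>e\<in>A. y \<le> e" if "t < T" "y \<in> reach A D x t u" for t y
      using Suc.prems(1)[of t y] that by simp
    show "reach A D x T (2*D) \<noteq> {}" using Suc.prems(2) reach_pred_nonempty by blast
  qed
  moreover have "int (card (reach A D x T u)) + max 0 (u - (front A D x (Suc T) - front A D x T))
     \<le> int (card (reach A D x (Suc T) u)) + int (card (lost A D x T u))"
    by (rule card_reach_step[OF x D Suc.prems(1)[of T] Suc.prems(2) u]) auto
  ultimately show ?case by simp
qed

lemma card_reach_upper:
  assumes "u \<le> 2*D"
  shows "int (card (reach A D x T u)) \<le> 1 + max 0 (int T * u - (front A D x T - x))"
proof (cases "reach A D x T u = {}")
  case False
  have sub: "reach A D x T u \<subseteq> {front A D x T..x + int T * u}"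
    using front_le[OF _ assms] reach_bounds by fastforce
  then have "card (reach A D x T u) \<le> card {front A D x T..x + int T * u}" by (intro card_mono) auto
  then show ?thesis by simp
qed simp

lemma front_0: "0 \<le> D \<Longrightarrow> front A D x 0 = x"
  by (simp add: front_def)

text \<open>If the front at time \<open>T\<close> has overtaken the speed \<open>u\<close>, then hardly any point is reachable
  at level \<open>u\<close>. Hence everything that level \<open>u\<close> had gained up to time \<open>s\<close> has been lost,
  and the gain was at least the lead of speed \<open>u\<close> over the front at time \<open>s\<close>. This is how fast
  acceleration of the front is charged to holes.\<close>
lemma slow_levels_are_lost:
  assumes x: "x \<in> A" and D: "0 \<le> D"
    and next_ex: "\<And>t y. t < T \<Longrightarrow> y \<in> reach A D x t u \<Longrightarrow> \<exists>e\<in>A. y \<le> e"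
    and ne: "reach A D x T (2*D) \<noteq> {}" and u: "D \<le> u" "u \<le> 2*D" and s: "s \<le> T"
    and passed: "int T * u \<le> front A D x T - x"
  shows "int s * u - (front A D x s - x) \<le> (\<Sum>t<T. int (card (lost A D x t u)))"
proof -
  let ?g = "\<lambda>t. front A D x (Suc t) - front A D x t"
  have lower: "1 + (\<Sum>t<T. max 0 (u - ?g t))
      \<le> int (card (reach A D x T u)) + (\<Sum>t<T. int (card (lost A D x t u)))"
    by (rule card_reach_lower[OF x D _ ne u]) (rule next_ex)
  have tele: "(\<Sum>t<s. ?g t) = front A D x s - x"
    using sum_lessThan_telescope[of "front A D x" s] front_0[OF D, of A x] by simp
  have "int s * u - (front A D x s - x) = (\<Sum>t<s. u - ?g t)" by (simp add: sum_subtractf flip: tele)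
  also have "\<dots> \<le> (\<Sum>t<s. max 0 (u - ?g t))" by (intro sum_mono) auto
  also have "\<dots> \<le> (\<Sum>t<T. max 0 (u - ?g t))" using s by (intro sum_mono2) auto
  finally show ?thesis
    using lower card_reach_upper[OF u(2), of A x T] passed by linarith
qed

lemma empty_levels_are_lost:
  assumes x: "x \<in> A" and D: "0 \<le> D"
    and next_ex: "\<And>t y. t < T \<Longrightarrow> y \<in> reach A D x t u \<Longrightarrow> \<exists>e\<in>A. y \<le> e"
    and ne: "reach A D x T (2*D) \<noteq> {}" and u: "D \<le> u" "u \<le> 2*D"
    and empty: "reach A D x T u = {}"
  shows "int T * u - (front A D x T - x) \<le> (\<Sum>t<T. int (card (lost A D x t u)))"
proof -
  let ?g = "\<lambda>t. front A D x (Suc t) - front A D x t"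
  have lower: "1 + (\<Sum>t<T. max 0 (u - ?g t))
      \<le> int (card (reach A D x T u)) + (\<Sum>t<T. int (card (lost A D x t u)))"
    by (rule card_reach_lower[OF x D _ ne u]) (rule next_ex)
  have tele: "(\<Sum>t<T. ?g t) = front A D x T - x"
    using sum_lessThan_telescope[of "front A D x" T] front_0[OF D, of A x] by simp
  have "int T * u - (front A D x T - x) = (\<Sum>t<T. u - ?g t)" by (simp add: sum_subtractf flip: tele)
  also have "\<dots> \<le> (\<Sum>t<T. max 0 (u - ?g t))" by (intro sum_mono) auto
  finally show ?thesis
    using lower empty by simp
qed

text \<open>Reachability is monotone in the level, so a point is lost only on a short window of levels above its
  entrance level.\<close>
lemma card_entrance_levels:
  fixes P :: "int \<Rightarrow> bool"
  assumes "finite B" "\<And>u v. P u \<Longrightarrow> u \<le> v \<Longrightarrow> P v" "0 \<le> m"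
  shows "int (card {u \<in> B. P u \<and> \<not> P (u - m)}) \<le> m"
proof (cases "{u \<in> B. P u \<and> \<not> P (u - m)} = {}")
  case False
  define U where "U = {u \<in> B. P u \<and> \<not> P (u - m)}"
  define b where "b = Min U"
  have fin: "finite U" and ne: "U \<noteq> {}" using assms(1) False by (auto simp: U_def)
  have b: "b \<in> U" unfolding b_def using fin ne by (rule Min_in)
  have "U \<subseteq> {b..<b + m}"
  proof
    fix u assume u: "u \<in> U"
    have "b \<le> u" unfolding b_def using fin u by (rule Min_le)
    moreover have "u < b + m"
    proof (rule ccontr)
      assume "\<not> u < b + m"
      then have "b \<le> u - m" by simp
      moreover have "P b" using b by (simp add: U_def)
      ultimately have "P (u - m)" by (rule assms(2)[rotated])
      then show False using u by (simp add: U_def)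
    qed
    ultimately show "u \<in> {b..<b + m}" by simp
  qed
  then have "card U \<le> card {b..<b + m}" by (intro card_mono) auto
  then show ?thesis unfolding U_def[symmetric] using assms(3) by simp
next
  case True
  then show ?thesis using assms(3) by (metis card.empty of_nat_0)
qed

lemma sum_card_lost:
  assumes "x \<in> A" "0 < D" "finite B" "\<And>u. u \<in> B \<Longrightarrow> u \<le> 2 * D"
  shows "(\<Sum>u\<in>B. int (card (lost A D x t u))) \<le> (\<Sum>y\<in>{x<..x + 2 * int t * D} - A. 2 * int (next_dist A y))"
proof -
  let ?Y = "{x<..x + 2 * int t * D} - A"
  have lY: "lost A D x t u \<subseteq> ?Y" if "u \<in> B" for u
  proof
    fix y assume y: "y \<in> lost A D x t u"
    then have r: "y \<in> reach A D x t u" "y \<notin> A" by (auto simp: lost_def)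
    then have "t \<noteq> 0" using assms(1) by (cases t) (auto split: if_splits)
    then have "0 < int t * D" using assms(2) by simp
    moreover have "int t * u \<le> int t * (2 * D)" using assms(4)[OF that] by (intro mult_left_mono) auto
    ultimately show "y \<in> ?Y" using reach_bounds[OF r(1)] r(2) by (auto simp: algebra_simps)
  qed
  have "(\<Sum>u\<in>B. int (card (lost A D x t u))) = (\<Sum>u\<in>B. \<Sum>y\<in>?Y. if y \<in> lost A D x t u then 1 else 0)"
  proof (rule sum.cong[OF refl])
    fix u assume "u \<in> B"
    then have "?Y \<inter> lost A D x t u = lost A D x t u" using lY by blast
    then show "int (card (lost A D x t u)) = (\<Sum>y\<in>?Y. if y \<in> lost A D x t u then 1 else 0)"
      by (simp add: sum.If_cases)
  qed
  also have "\<dots> = (\<Sum>y\<in>?Y. \<Sum>u\<in>B. if y \<in> lost A D x t u then 1 else 0)" by (rule sum.swap)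
  also have "\<dots> \<le> (\<Sum>y\<in>?Y. 2 * int (next_dist A y))"
  proof (rule sum_mono)
    fix y assume y: "y \<in> ?Y"
    have eq: "B \<inter> {u. y \<in> lost A D x t u} = {u \<in> B. y \<in> reach A D x t u \<and> \<not> y \<in> reach A D x t (u - 2 * int (next_dist A y))}"
      using y by (auto simp: lost_def)
    have "(\<Sum>u\<in>B. if y \<in> lost A D x t u then 1 else 0) = int (card (B \<inter> {u. y \<in> lost A D x t u}))"
      using assms(3) by (simp add: sum.If_cases)
    also have "\<dots> \<le> 2 * int (next_dist A y)"
      unfolding eq by (rule card_entrance_levels[OF assms(3)]) (auto intro: reach_mono)
    finally show "(\<Sum>u\<in>B. if y \<in> lost A D x t u then 1 else 0) \<le> 2 * int (next_dist A y)" .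
  qed
  finally show ?thesis .
qed

section \<open>The cost of holes\<close>

text \<open>Summing \<open>hole_weight A D\<close> over a hole of length \<open>h\<close> gives about \<open>min(h, D)\<^sup>2 / 2\<close>. The cutoff, rather than
  \<open>min(prev_dist, D)\<close>, keeps a long hole from contributing at every smaller scale in
  \<open>sum_hole_weight_over_scales\<close>.\<close>
definition hole_weight :: "int set \<Rightarrow> int \<Rightarrow> int \<Rightarrow> real" where
  "hole_weight A D z = (if int (prev_dist A z) \<le> D then real (prev_dist A z) else 0)"

definition hole_cost :: "int set \<Rightarrow> int \<Rightarrow> int \<Rightarrow> int \<Rightarrow> real" where
  "hole_cost A D x Y = (\<Sum>z\<in>{x<..x + Y}. hole_weight A D z)"

lemma hole_weight_nonneg: "0 \<le> hole_weight A D z" by (simp add: hole_weight_def)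

lemma hole_cost_mono: "Y \<le> Z \<Longrightarrow> hole_cost A D x Y \<le> hole_cost A D x Z"
  unfolding hole_cost_def by (intro sum_mono2) (auto simp: hole_weight_nonneg)

lemma hole_cost_subset:
  assumes "x \<le> x'" "x' + Y' \<le> x + Y"
  shows "hole_cost A D x' Y' \<le> hole_cost A D x Y"
  unfolding hole_cost_def using assms by (intro sum_mono2) (auto simp: hole_weight_nonneg)

text \<open>The cost is collected from the left end of the hole, which lies to the right of \<open>x \<in> A\<close>.\<close>
lemma hole_cost_ge_square:
  assumes x: "x \<in> A" "x \<le> y" and h: "int h \<le> D" and empty: "\<And>k. k < h \<Longrightarrow> y + int k \<notin> A"
  shows "real h * (real h + 1) / 2 \<le> hole_cost A D x (y + int h - x)"
proof (cases "h = 0")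
  case True
  then show ?thesis by (simp add: hole_cost_def sum_nonneg hole_weight_nonneg)
next
  case False
  define p where "p = y - int (prev_dist A y)"
  have p: "p \<in> A" unfolding p_def using prev_dist_in[OF x] .
  have px: "x \<le> p" unfolding p_def using prev_dist_le[OF x] by simp
  have "y \<notin> A" using empty[of 0] False by simp
  then have py: "p < y" using p unfolding p_def by (cases "prev_dist A y") auto
  have gap: "z \<notin> A" if "p < z" "z < y + int h" for z
  proof (cases "z \<le> y")
    case True
    then have "y - int (nat (y - z)) \<notin> A" using that unfolding p_def by (intro prev_dist_notin) linarith
    then show ?thesis using True by simp
  next
    case False
    then have "y + int (nat (z - y)) \<notin> A" using that by (intro empty) linarith
    then show ?thesis using False by simp
  qed
  have prev_dist: "prev_dist A (p + int k) = k" if "k \<le> h" for k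
  proof (rule antisym)
    show "prev_dist A (p + int k) \<le> k" using prev_dist_le[OF p, of "p + int k"] by simp
    show "k \<le> prev_dist A (p + int k)"
    proof (rule ccontr)
      assume "\<not> k \<le> prev_dist A (p + int k)"
      moreover have "p + int k - int (prev_dist A (p + int k)) \<in> A" by (rule prev_dist_in[OF p]) simp
      ultimately show False using gap[of "p + int k - int (prev_dist A (p + int k))"] that py by simp
    qed
  qed
  have inj: "inj_on (\<lambda>k. p + int k) {1..h}" by (auto simp: inj_on_def)
  have "real h * (real h + 1) / 2 = (\<Sum>k\<in>{1..h}. real k)"
    by (induction h) (auto simp: field_simps)
  also have "\<dots> = (\<Sum>k\<in>{1..h}. hole_weight A D (p + int k))"
    by (intro sum.cong) (use prev_dist h in \<open>auto simp: hole_weight_def\<close>)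
  also have "\<dots> = (\<Sum>z\<in>(\<lambda>k. p + int k) ` {1..h}. hole_weight A D z)" by (simp only: sum.reindex[OF inj] o_def)
  also have "\<dots> \<le> hole_cost A D x (y + int h - x)"
    unfolding hole_cost_def using px py by (intro sum_mono2) (auto simp: hole_weight_nonneg)
  finally show ?thesis .
qed

lemma next_dist_small:
  assumes x: "x \<in> A" "x \<le> y" and h: "0 \<le> h" "h \<le> D"
    and cost: "hole_cost A D x (y + h - x) < (real_of_int h)\<^sup>2 / 2"
  shows "int (next_dist A y) < h" "y + int (next_dist A y) \<in> A"
proof -
  have "\<exists>k<nat h. y + int k \<in> A"
  proof (rule ccontr)
    assume "\<not> ?thesis"
    then have "real (nat h) * (real (nat h) + 1) / 2 \<le> hole_cost A D x (y + int (nat h) - x)"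
      using h by (intro hole_cost_ge_square x) auto
    moreover have "real (nat h) = real_of_int h" "int (nat h) = h" using h by auto
    ultimately show False using cost h by (auto simp: power2_eq_square algebra_simps)
  qed
  then obtain k where k: "k < nat h" "y + int k \<in> A" by blast
  have "y + int (next_dist A y) \<le> y + int k" using next_dist_le[OF k(2), of y] by simp
  then show "int (next_dist A y) < h" using k by linarith
  show "y + int (next_dist A y) \<in> A" using next_dist_in[OF k(2), of y] by simp
qed

text \<open>Both sides count pairs \<open>y \<le> z\<close> such that \<open>A\<close> has no point in \<open>[y, z]\<close>: \<open>next_dist\<close> counts them by their
  left and \<open>prev_dist\<close> by their right element. The cost hypothesis bounds the length of all holes involved, so
  that the cutoff in \<open>hole_weight\<close> does not matter and the pairs stay within distance \<open>Y + h\<close> of \<open>x\<close>.\<close>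
lemma sum_nxt_le_hole_cost:
  assumes x: "x \<in> A" and h: "0 < h" "h \<le> D" and Y: "0 \<le> Y"
    and cost: "hole_cost A D x (Y + 2 * h) < (real_of_int h)\<^sup>2 / 2"
  shows "(\<Sum>y\<in>{x<..x + Y} - A. real (next_dist A y)) \<le> hole_cost A D x (Y + h)"
proof -
  let ?Y = "{x<..x + Y} - A" and ?Z = "{x<..x + (Y + h)}"
  have small: "int (next_dist A y) < h" "y + int (next_dist A y) \<in> A" if "x \<le> y" "y \<le> x + Y + h" for y
  proof -
    have "hole_cost A D x (y + h - x) \<le> hole_cost A D x (Y + 2 * h)"
      using that by (intro hole_cost_mono) auto
    then have "hole_cost A D x (y + h - x) < (real_of_int h)\<^sup>2 / 2" using cost by simp
    from next_dist_small[OF x that(1) _ h(2) this] h show "int (next_dist A y) < h" "y + int (next_dist A y) \<in> A" by auto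
  qed
  have ellh: "int (prev_dist A z) \<le> h" if z: "z \<in> ?Z" for z
  proof (rule ccontr)
    assume a: "\<not> int (prev_dist A z) \<le> h"
    let ?y = "z - h"
    have "int (prev_dist A z) \<le> z - x" using prev_dist_le[OF x, of z] z by simp
    then have "x \<le> ?y" using a by simp
    then have n: "int (next_dist A ?y) < h" "?y + int (next_dist A ?y) \<in> A" using small[of ?y] z h by auto
    have "z - int (nat (h - int (next_dist A ?y))) \<notin> A" using a n by (intro prev_dist_notin) linarith
    then show False using n by (simp add: algebra_simps)
  qed
  have "(\<Sum>y\<in>?Y. real (next_dist A y)) = (\<Sum>y\<in>?Y. \<Sum>z\<in>?Z. if y \<le> z \<and> z < y + int (next_dist A y) then 1 else 0)"
  proof (rule sum.cong[OF refl])
    fix y assume y: "y \<in> ?Y"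
    have "?Z \<inter> {z. y \<le> z \<and> z < y + int (next_dist A y)} = {y..<y + int (next_dist A y)}"
      using y small(1)[of y] h by auto
    then show "real (next_dist A y) = (\<Sum>z\<in>?Z. if y \<le> z \<and> z < y + int (next_dist A y) then 1 else 0)"
      by (simp add: sum.If_cases)
  qed
  also have "\<dots> = (\<Sum>z\<in>?Z. \<Sum>y\<in>?Y. if y \<le> z \<and> z < y + int (next_dist A y) then 1 else 0)" by (rule sum.swap)
  also have "\<dots> \<le> (\<Sum>z\<in>?Z. hole_weight A D z)"
  proof (rule sum_mono)
    fix z assume z: "z \<in> ?Z"
    have "?Y \<inter> {y. y \<le> z \<and> z < y + int (next_dist A y)} \<subseteq> {z - int (prev_dist A z)<..z}"
    proof
      fix y assume y: "y \<in> ?Y \<inter> {y. y \<le> z \<and> z < y + int (next_dist A y)}"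
      have "z - int (prev_dist A z) \<in> A" using prev_dist_in[OF x, of z] z by simp
      moreover have "y + int k \<notin> A" if "k < next_dist A y" for k using next_dist_notin[OF that] .
      ultimately have "\<not> y \<le> z - int (prev_dist A z)"
      proof -
        assume a: "z - int (prev_dist A z) \<in> A" "\<And>k. k < next_dist A y \<Longrightarrow> y + int k \<notin> A"
        show ?thesis
        proof
          assume b: "y \<le> z - int (prev_dist A z)"
          have "y + int (nat (z - int (prev_dist A z) - y)) \<notin> A" using y b by (intro a(2)) auto
          then show False using a(1) b by simp
        qed
      qed
      then show "y \<in> {z - int (prev_dist A z)<..z}" using y by auto
    qed
    then have "card (?Y \<inter> {y. y \<le> z \<and> z < y + int (next_dist A y)}) \<le> card {z - int (prev_dist A z)<..z}"
      by (intro card_mono) auto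
    also have "\<dots> = prev_dist A z" by simp
    finally have "card (?Y \<inter> {y. y \<le> z \<and> z < y + int (next_dist A y)}) \<le> prev_dist A z" .
    moreover have "hole_weight A D z = real (prev_dist A z)" using ellh[OF z] h by (simp add: hole_weight_def)
    ultimately show "(\<Sum>y\<in>?Y. if y \<le> z \<and> z < y + int (next_dist A y) then 1 else 0) \<le> hole_weight A D z"
      by (simp add: sum.If_cases)
  qed
  finally show ?thesis by (simp add: hole_cost_def)
qed

section \<open>Waves at one scale from a clean start\<close>

text \<open>The exponent \<open>1/2\<close> serves two purposes. It is positive, so the damage near the start is so small that the drifts
  of the front over successive doublings of time form a geometric series. It is less than 1, so
  the condition follows from an average over starting points: \<open>\<Sum>\<^sub>d d\<^sup>-\<^sup>1\<^sup>/\<^sup>2\<close> over \<open>d \<le> K D\<close> is of the order of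
  its last term times \<open>K D\<close>.\<close>
definition clean :: "int set \<Rightarrow> int \<Rightarrow> nat \<Rightarrow> int \<Rightarrow> bool" where
  "clean A D K x \<longleftrightarrow> x \<in> A \<and> (\<forall>Y. D \<le> Y \<and> Y \<le> 4 * int K * D \<longrightarrow>
     hole_cost A D x Y \<le> sqrt (real_of_int Y / (real K * real_of_int D)) * (real_of_int D)\<^sup>2 / 10^6)"

locale clean_start =
  fixes A :: "int set" and D m :: int and K :: nat and x :: int
  assumes clean: "clean A D K x" and D8: "D = 8 * m" and DK: "200 * int K \<le> D" and K1: "1 \<le> K"
begin

lemma xA: "x \<in> A" using clean by (simp add: clean_def)

lemma Dpos: "0 < D" using DK K1 by linarith

lemma mpos: "0 < m" using Dpos D8 by simp

lemma KD: "D \<le> int K * D"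
  using mult_right_mono[of 1 "int K" D] Dpos K1 by simp

lemma cost_le:
  assumes "D \<le> Y" "Y \<le> 4 * int K * D"
  shows "hole_cost A D x Y \<le> sqrt (real_of_int Y / (real K * real_of_int D)) * (real_of_int D)\<^sup>2 / 10^6"
  using clean assms by (simp add: clean_def)

text \<open>In particular all holes near the start are shorter than \<open>D/2 = 4 m\<close>.\<close>
lemma cost_total: "hole_cost A D x (4 * int K * D) < (real_of_int (4 * m))\<^sup>2 / 2"
proof -
  have "hole_cost A D x (4 * int K * D) \<le> sqrt (real_of_int (4 * int K * D) / (real K * real_of_int D)) * (real_of_int D)\<^sup>2 / 10^6"
    by (rule cost_le) (use KD Dpos in linarith)+
  also have "real_of_int (4 * int K * D) / (real K * real_of_int D) = 2\<^sup>2" using K1 Dpos by simp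
  also have "sqrt (2\<^sup>2) * (real_of_int D)\<^sup>2 / 10^6 < (real_of_int (4 * m))\<^sup>2 / 2"
    using mpos unfolding D8 by (simp add: power2_eq_square)
  finally show ?thesis .
qed

lemma next_dist_small_here:
  assumes "x \<le> y" "y + 4 * m \<le> x + 4 * int K * D"
  shows "int (next_dist A y) < 4 * m" "y + int (next_dist A y) \<in> A"
proof -
  have "hole_cost A D x (y + 4 * m - x) \<le> hole_cost A D x (4 * int K * D)"
    using assms by (intro hole_cost_mono) auto
  then have "hole_cost A D x (y + 4 * m - x) < (real_of_int (4 * m))\<^sup>2 / 2" using cost_total by simp
  from next_dist_small[OF xA assms(1) _ _ this] mpos D8
  show "int (next_dist A y) < 4 * m" "y + int (next_dist A y) \<in> A" by auto
qed

lemma reach_near: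
  assumes "t \<le> K" "y \<in> reach A D x t u" "u \<le> 2 * D"
  shows "x \<le> y" "y + 4 * m \<le> x + 4 * int K * D"
proof -
  have b: "x + int t * D \<le> y" "y \<le> x + int t * u" using reach_bounds[OF assms(2)] by auto
  have "0 \<le> int t * D" using Dpos by simp
  then show "x \<le> y" using b by simp
  have "int t * u \<le> int K * (2 * D)" using assms reach_ge[OF assms(2)] Dpos by (intro mult_mono) auto
  then show "y + 4 * m \<le> x + 4 * int K * D" using b(2) KD D8 mpos by linarith
qed

lemma next_ex:
  assumes "t \<le> K" "y \<in> reach A D x t u" "u \<le> 2 * D"
  shows "\<exists>e\<in>A. y \<le> e"
  by (rule bexI[OF _ next_dist_small_here(2)[OF reach_near[OF assms]]]) simp

text \<open>Every step before time \<open>T\<close> loses at most twice the cost of the holes within distance \<open>2 T D\<close>.\<close>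
lemma total_loss:
  assumes T: "1 \<le> T" "T \<le> K" and B: "finite B" "B \<subseteq> {D..2*D}"
  shows "(\<Sum>u\<in>B. real_of_int (\<Sum>t<T. int (card (lost A D x t u))))
     \<le> 3 / 10^6 * real T * sqrt (real T / real K) * (real_of_int D)\<^sup>2"
proof -
  let ?H = "hole_cost A D x (2 * int T * D)"
  have TK: "int T * D \<le> int K * D" using T Dpos by (intro mult_right_mono) auto
  have TD: "D \<le> int T * D" using mult_right_mono[of 1 "int T" D] Dpos T by simp
  have each: "(\<Sum>u\<in>B. real (card (lost A D x t u))) \<le> 2 * ?H" if t: "t < T" for t
  proof -
    have tD: "int t * D + D \<le> int T * D"
      using mult_right_mono[of "int t + 1" "int T" D] t Dpos by (simp add: algebra_simps)
    have "(\<Sum>u\<in>B. int (card (lost A D x t u))) \<le> (\<Sum>y\<in>{x<..x + 2 * int t * D} - A. 2 * int (next_dist A y))"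
      by (rule sum_card_lost) (use xA Dpos B in auto)
    then have "real_of_int (\<Sum>u\<in>B. int (card (lost A D x t u)))
        \<le> real_of_int (\<Sum>y\<in>{x<..x + 2 * int t * D} - A. 2 * int (next_dist A y))" by (simp only: of_int_le_iff)
    then have "(\<Sum>u\<in>B. real (card (lost A D x t u))) \<le> 2 * (\<Sum>y\<in>{x<..x + 2 * int t * D} - A. real (next_dist A y))"
      by (simp add: sum_distrib_left)
    also have "(\<Sum>y\<in>{x<..x + 2 * int t * D} - A. real (next_dist A y)) \<le> hole_cost A D x (2 * int t * D + 4 * m)"
    proof (rule sum_nxt_le_hole_cost[OF xA])
      have "hole_cost A D x (2 * int t * D + 2 * (4 * m)) \<le> hole_cost A D x (4 * int K * D)"
        using tD TK Dpos D8 mult_nonneg_nonneg[of "int t" D] by (intro hole_cost_mono) linarith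
      then show "hole_cost A D x (2 * int t * D + 2 * (4 * m)) < (real_of_int (4 * m))\<^sup>2 / 2"
        using cost_total by simp
    qed (use mpos D8 Dpos in auto)
    also have "hole_cost A D x (2 * int t * D + 4 * m) \<le> ?H"
      using tD Dpos D8 by (intro hole_cost_mono) linarith
    finally show ?thesis by simp
  qed
  have sq: "sqrt (real_of_int (2 * int T * D) / (real K * real_of_int D)) = sqrt 2 * sqrt (real T / real K)"
  proof -
    have "real_of_int (2 * int T * D) / (real K * real_of_int D) = 2 * (real T / real K)"
      using Dpos K1 by (simp add: field_simps)
    then show ?thesis by (simp only: real_sqrt_mult)
  qed
  have "?H \<le> sqrt (real_of_int (2 * int T * D) / (real K * real_of_int D)) * (real_of_int D)\<^sup>2 / 10^6"
    by (rule cost_le) (use TK TD Dpos in linarith)+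
  then have H: "?H \<le> sqrt 2 * sqrt (real T / real K) * (real_of_int D)\<^sup>2 / 10^6" unfolding sq .
  have "(\<Sum>u\<in>B. real_of_int (\<Sum>t<T. int (card (lost A D x t u)))) = (\<Sum>t<T. \<Sum>u\<in>B. real (card (lost A D x t u)))"
    by (simp, rule sum.swap)
  also have "\<dots> \<le> (\<Sum>t<T. 2 * ?H)" using each by (intro sum_mono) auto
  also have "\<dots> = 2 * real T * ?H" by simp
  also have "\<dots> \<le> 2 * real T * (sqrt 2 * sqrt (real T / real K) * (real_of_int D)\<^sup>2 / 10^6)"
    using H by (intro mult_left_mono) auto
  also have "\<dots> = (2 * sqrt 2) * (real T * sqrt (real T / real K) * (real_of_int D)\<^sup>2 / 10^6)" by simp
  also have "\<dots> \<le> 3 * (real T * sqrt (real T / real K) * (real_of_int D)\<^sup>2 / 10^6)"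
  proof (rule mult_right_mono)
    have "sqrt 2 \<le> 3/2" by (rule real_le_lsqrt) (auto simp: power2_eq_square)
    then show "2 * sqrt 2 \<le> (3::real)" by simp
  qed auto
  finally show ?thesis by simp
qed

text \<open>Up to constant factors, the relative excess speed of the front after \<open>T\<close> steps: the square root of
  the damage \<open>sqrt (T / K)\<close>, in units of \<open>D\<^sup>2\<close>, that \<open>clean\<close> admits within distance \<open>O(T D)\<close>.\<close>
definition drift :: "nat \<Rightarrow> real" where
  "drift T = sqrt (sqrt (real T / real K))"

lemma drift_pow2: "(drift T)\<^sup>2 = sqrt (real T / real K)"
  by (simp add: drift_def)

lemma drift_le_1: "T \<le> K \<Longrightarrow> drift T \<le> 1"
  using K1 by (simp add: drift_def)

lemma drift_nonneg: "0 \<le> drift T" by (simp add: drift_def)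

lemma drift_lower: "1 \<le> T \<Longrightarrow> 1 / real K \<le> drift T"
proof -
  assume T: "1 \<le> T"
  have k: "0 < real K" "1 \<le> real K" using K1 by auto
  have "1 / real K \<le> real T / real K" using T k by (simp add: divide_right_mono)
  have "(1 / real K)\<^sup>2 \<le> 1 / real K" using k by (simp add: power2_eq_square field_simps)
  have p4: "(1 / real K)^2 \<le> sqrt (real T / real K)"
  proof (rule real_le_rsqrt)
    have "((1 / real K)\<^sup>2)\<^sup>2 \<le> (1 / real K)\<^sup>2"
      using k by (intro power2_le_iff_abs_le[THEN iffD2]) (auto simp: power2_eq_square field_simps)
    then show "((1 / real K)\<^sup>2)\<^sup>2 \<le> real T / real K"
      using \<open>(1 / real K)\<^sup>2 \<le> 1 / real K\<close> \<open>1 / real K \<le> real T / real K\<close> by linarith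
  qed
  show ?thesis unfolding drift_def by (rule real_le_rsqrt[OF p4])
qed

lemma drift_half:
  assumes "3 * s \<le> 2 * T"
  shows "drift s \<le> 91/100 * drift T"
proof -
  define c :: real where "c = 91/100"
  have c: "0 \<le> c" "2/3 \<le> (c\<^sup>2)\<^sup>2" unfolding c_def by (simp_all add: power_divide)
  have "real (3 * s) \<le> real (2 * T)" using assms by (simp only: of_nat_le_iff)
  then have "real s \<le> 2/3 * real T" by simp
  then have "real s / real K \<le> 2/3 * real T / real K" by (intro divide_right_mono) auto
  then have "real s / real K \<le> 2/3 * (real T / real K)" by simp
  also have "\<dots> \<le> (c\<^sup>2)\<^sup>2 * (real T / real K)" using c by (intro mult_right_mono) auto
  finally have "drift s \<le> sqrt (sqrt ((c\<^sup>2)\<^sup>2 * (real T / real K)))"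
    unfolding drift_def by (intro real_sqrt_le_mono)
  also have "\<dots> = c * drift T"
    unfolding drift_def by (simp only: real_sqrt_mult real_sqrt_abs abs_power2 abs_of_nonneg[OF c(1)])
  finally show ?thesis unfolding c_def .
qed

text \<open>By strong induction, comparing time \<open>T\<close> with \<open>s = \<lceil>T/2\<rceil>\<close>. If the mean speed of the front exceeded
  \<open>bT\<close> at time \<open>T\<close> while it was at most \<open>bs\<close> at time \<open>s\<close>, then each of the about \<open>\<Delta>/2\<close> levels in the
  upper half of \<open>[bs, bT]\<close> would have lost at least \<open>s \<Delta> / 2\<close> points by \<open>slow_levels_are_lost\<close>, together more
  than \<open>total_loss\<close> allows.\<close>
lemma front_bound:
  assumes "T \<le> K" "reach A D x T (2*D) \<noteq> {}"
  shows "real_of_int (front A D x T - x) \<le> real T * (real_of_int D * (1 + drift T / 4))"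
  using assms
proof (induction T rule: less_induct)
  case (less T)
  have D0: "0 < real_of_int D" using Dpos by simp
  consider "T = 0" | "T = 1" | "2 \<le> T" by linarith
  then show ?case
  proof cases
    case 1
    then show ?thesis using front_0[of D A x] Dpos by simp
  next
    case 2
    have "x \<in> reach A D x 0 D" by simp
    from reach_step[OF xA this, of "2*D"] have "x + D \<in> reach A D x 1 (2*D)" using Dpos by simp
    then have "front A D x T - x \<le> D" using front_le[of "x + D" A D x 1 "2*D"] 2 by simp
    then have "real_of_int (front A D x T - x) \<le> real_of_int D" by (simp only: of_int_le_iff)
    also have "\<dots> \<le> real T * (real_of_int D * (1 + drift T / 4))"
      using 2 D0 drift_nonneg[of T] by (simp add: algebra_simps)
    finally show ?thesis .
  next
    case 3
    \<comment> \<open>Rounding up keeps \<open>s \<le> 2/3 T\<close> for all \<open>T \<ge> 2\<close>, which is what \<open>drift_half\<close> needs.\<close>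
  define s where "s = (T + 1) div 2"
    have s: "1 \<le> s" "s < T" "3 * s \<le> 2 * T" "T \<le> 2 * s" using 3 unfolding s_def by auto
    define bs where "bs = real_of_int D * (1 + drift s / 4)"
    define bT where "bT = real_of_int D * (1 + drift T / 4)"
    define \<Delta> where "\<Delta> = bT - bs"
    have IH: "real_of_int (front A D x s - x) \<le> real s * bs" unfolding bs_def
      using less.IH[OF s(2)] less.prems s reach_nonempty_le[of s T A D x "2*D"] by simp
    have dT: "0 < drift T" using 3 K1 by (simp add: drift_def)
    have "real_of_int D * (9/100 * drift T) \<le> real_of_int D * (drift T - drift s)"
      using drift_half[OF s(3)] D0 by (intro mult_left_mono) auto
    then have \<Delta>1: "9/400 * (real_of_int D * drift T) \<le> \<Delta>" unfolding \<Delta>_def bs_def bT_def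
      by (simp add: algebra_simps)
    have "200 \<le> real_of_int D * drift T"
    proof -
      have "200 * real K \<le> real_of_int D" using DK by linarith
      then have "200 \<le> real_of_int D * (1 / real K)" using K1 by (simp add: field_simps)
      also have "\<dots> \<le> real_of_int D * drift T" using drift_lower[of T] 3 D0 by (intro mult_left_mono) auto
      finally show ?thesis .
    qed
    \<comment> \<open>The upper half of \<open>[bs, bT]\<close> is long enough to contain at least \<open>\<Delta>/4\<close> integers.\<close>
    then have \<Delta>4: "4 \<le> \<Delta>" using \<Delta>1 by linarith
    have bsD: "real_of_int D \<le> bs" unfolding bs_def using D0 drift_nonneg[of s] by simp
    have bTD: "bT \<le> 2 * real_of_int D" unfolding bT_def using D0 drift_le_1[OF less.prems(1)] by simp
    show ?thesis
    proof (rule ccontr)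
      assume neg: "\<not> ?thesis"
      then have neg: "real T * bT < real_of_int (front A D x T - x)" unfolding bT_def by simp
      define B where "B = {\<lceil>bs + \<Delta>/2\<rceil>..\<lfloor>bT\<rfloor>}"
      have Bu: "bs + \<Delta>/2 \<le> real_of_int u" "real_of_int u \<le> bT" if "u \<in> B" for u
        using that unfolding B_def by (auto simp: ceiling_le_iff le_floor_iff)
      have BD: "B \<subseteq> {D..2*D}"
      proof
        fix u assume u: "u \<in> B"
        have "real_of_int D \<le> real_of_int u" "real_of_int u \<le> real_of_int (2 * D)"
          using Bu[OF u] bsD bTD \<Delta>4 by auto
        then show "u \<in> {D..2*D}" by (simp only: of_int_le_iff atLeastAtMost_iff)
      qed
      have cB: "\<Delta> / 4 \<le> real (card B)"
      proof -
        define N where "N = \<lfloor>bT\<rfloor> - \<lceil>bs + \<Delta>/2\<rceil> + 1"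
        have "bT - (bs + \<Delta>/2) - 1 \<le> real_of_int N" unfolding N_def by linarith
        moreover have "bT - (bs + \<Delta>/2) = \<Delta>/2" unfolding \<Delta>_def by (simp add: field_simps)
        ultimately have "\<Delta>/4 \<le> real_of_int N" using \<Delta>4 by linarith
        then have "\<Delta>/4 \<le> real_of_int (\<lfloor>bT\<rfloor> - \<lceil>bs + \<Delta>/2\<rceil> + 1)" unfolding N_def .
        then show ?thesis unfolding B_def by simp
      qed
      have lower: "real s * (\<Delta>/2) \<le> real_of_int (\<Sum>t<T. int (card (lost A D x t u)))" if u: "u \<in> B" for u
      proof -
        have uD: "D \<le> u" "u \<le> 2*D" using BD u by auto
        have "real T * real_of_int u \<le> real T * bT" using Bu(2)[OF u] by (intro mult_left_mono) auto
        then have "real_of_int (int T * u) \<le> real_of_int (front A D x T - x)" using neg by simp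
        then have passed: "int T * u \<le> front A D x T - x" by (simp only: of_int_le_iff)
        have "int s * u - (front A D x s - x) \<le> (\<Sum>t<T. int (card (lost A D x t u)))"
        proof (rule slow_levels_are_lost[OF xA _ _ less.prems(2) uD _ passed])
          show "\<exists>e\<in>A. y \<le> e" if "t < T" "y \<in> reach A D x t u" for t y
            by (rule next_ex[OF _ that(2) uD(2)]) (use that(1) less.prems(1) in simp)
        qed (use Dpos s in auto)
        then have "real_of_int (int s * u - (front A D x s - x)) \<le> real_of_int (\<Sum>t<T. int (card (lost A D x t u)))"
          by (simp only: of_int_le_iff)
        moreover have "real s * (\<Delta>/2) \<le> real_of_int (int s * u - (front A D x s - x))"
        proof -
          have "real s * (bs + \<Delta>/2) \<le> real s * real_of_int u" using Bu(1)[OF u] by (intro mult_left_mono) auto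
          then show ?thesis using IH by (simp add: algebra_simps)
        qed
        ultimately show ?thesis by linarith
      qed
      have "real (card B) * (real s * (\<Delta>/2)) \<le> (\<Sum>u\<in>B. real_of_int (\<Sum>t<T. int (card (lost A D x t u))))"
        using sum_bounded_below[of B "real s * (\<Delta>/2)" "\<lambda>u. real_of_int (\<Sum>t<T. int (card (lost A D x t u)))"] lower by simp
      also have "\<dots> \<le> 3 / 10^6 * real T * sqrt (real T / real K) * (real_of_int D)\<^sup>2"
        by (rule total_loss) (use 3 less.prems BD in \<open>auto simp: B_def\<close>)
      finally have up: "real (card B) * (real s * (\<Delta>/2)) \<le> 3 / 10^6 * real T * (drift T)\<^sup>2 * (real_of_int D)\<^sup>2"
        unfolding drift_pow2 .
      have "(\<Delta>/4) * ((real T / 2) * (\<Delta>/2)) \<le> real (card B) * (real s * (\<Delta>/2))"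
        using cB s \<Delta>4 by (intro mult_mono) auto
      then have "real T * (\<Delta>\<^sup>2 / 16) \<le> real T * (3 / 10^6 * (real_of_int D * drift T)\<^sup>2)"
        using up by (simp add: power2_eq_square algebra_simps)
      then have "\<Delta>\<^sup>2 / 16 \<le> 3 / 10^6 * (real_of_int D * drift T)\<^sup>2" using 3 by simp
      moreover have "(9/400 * (real_of_int D * drift T))\<^sup>2 \<le> \<Delta>\<^sup>2"
        using \<Delta>1 D0 dT by (intro power_mono) auto
      moreover have "0 < (real_of_int D * drift T)\<^sup>2" using D0 dT by simp
      ultimately show False by (simp add: power_mult_distrib power_divide)
    qed
  qed
qed

text \<open>The levels between \<open>11/8 D\<close> and \<open>3/2 D\<close> exceed the mean speed of the front by at least \<open>D/8\<close>; together they
  gain more than the total loss, so one of them is nonempty. The next point of \<open>A\<close> is less than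
  \<open>D/2\<close> away and so reachable within level \<open>2 D\<close>.\<close>
lemma reach_in_A:
  assumes "T \<le> K" "reach A D x T (2*D) \<noteq> {}"
  shows "\<exists>e\<in>A. e \<in> reach A D x T (2*D)"
proof (cases T)
  case 0
  then show ?thesis using xA Dpos by auto
next
  case (Suc T')
  have T1: "1 \<le> T" using Suc by simp
  define B where "B = {11 * m..<12 * m}"
  have BD: "B \<subseteq> {D..2*D}" using mpos unfolding B_def D8 by auto
  have "\<exists>u\<in>B. reach A D x T u \<noteq> {}"
  proof (rule ccontr)
    assume neg: "\<not> ?thesis"
    have "real_of_int (front A D x T - x) \<le> real T * (real_of_int D * (1 + drift T / 4))"
      by (rule front_bound[OF assms])
    also have "\<dots> \<le> real T * (real_of_int D * (1 + 1 / 4))"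
      using drift_le_1[OF assms(1)] Dpos by (intro mult_left_mono) auto
    also have "\<dots> = real_of_int (int T * (10 * m))" using D8 by simp
    finally have fr: "front A D x T - x \<le> int T * (10 * m)" by (simp only: of_int_le_iff)
    have lower: "real_of_int (int T * m) \<le> real_of_int (\<Sum>t<T. int (card (lost A D x t u)))" if u: "u \<in> B" for u
    proof -
      have uD: "D \<le> u" "u \<le> 2*D" using BD u by auto
      have "int T * u - (front A D x T - x) \<le> (\<Sum>t<T. int (card (lost A D x t u)))"
      proof (rule empty_levels_are_lost[OF xA _ _ assms(2) uD])
        show "\<exists>e\<in>A. y \<le> e" if "t < T" "y \<in> reach A D x t u" for t y
          by (rule next_ex[OF _ that(2) uD(2)]) (use that(1) assms(1) in simp)
      qed (use Dpos neg u in auto)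
      moreover have "int T * (11 * m) \<le> int T * u" using u unfolding B_def by (intro mult_left_mono) auto
      ultimately have "int T * m \<le> (\<Sum>t<T. int (card (lost A D x t u)))" using fr by linarith
      then show ?thesis by (simp only: of_int_le_iff)
    qed
    have "real (card B) * real_of_int (int T * m) \<le> (\<Sum>u\<in>B. real_of_int (\<Sum>t<T. int (card (lost A D x t u))))"
      using sum_bounded_below[of B "real_of_int (int T * m)" "\<lambda>u. real_of_int (\<Sum>t<T. int (card (lost A D x t u)))"] lower by simp
    also have "\<dots> \<le> 3 / 10^6 * real T * sqrt (real T / real K) * (real_of_int D)\<^sup>2"
      by (rule total_loss) (use T1 assms BD in \<open>auto simp: B_def\<close>)
    also have "\<dots> \<le> 3 / 10^6 * real T * 1 * (real_of_int D)\<^sup>2"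
      using assms(1) K1 by (intro mult_mono) auto
    finally have "real_of_int m * (real T * real_of_int m) \<le> 3 / 10^6 * real T * (8 * real_of_int m)\<^sup>2"
      using mpos by (simp add: B_def D8)
    then have "real T * ((real_of_int m)\<^sup>2 * (1 - 192 / 10^6)) \<le> 0" by (simp add: power2_eq_square algebra_simps)
    moreover have "0 < real T * ((real_of_int m)\<^sup>2 * (1 - 192 / 10^6))" using T1 mpos by simp
    ultimately show False by linarith
  qed
  then obtain u y where u: "u \<in> B" and y: "y \<in> reach A D x T u" by blast
  have uD: "u \<le> 2 * D" using BD u by auto
  have n: "int (next_dist A y) < 4 * m" "y + int (next_dist A y) \<in> A"
    using next_dist_small_here[OF reach_near[OF assms(1) y uD]] by auto
  have "y + int (next_dist A y) \<in> reach A D x T (u + int (next_dist A y))"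
    using y unfolding Suc by (intro reach_shift) auto
  then have "y + int (next_dist A y) \<in> reach A D x T (2 * D)"
    by (rule reach_mono) (use n u in \<open>auto simp: B_def D8\<close>)
  then show ?thesis using n by blast
qed

lemma reach_alive: "T \<le> K \<Longrightarrow> \<exists>e\<in>A. e \<in> reach A D x T (2*D)"
proof (induction T)
  case 0
  then show ?case using xA Dpos by auto
next
  case (Suc T)
  then obtain e where "e \<in> A" "e \<in> reach A D x T (2*D)" by auto
  then have "e + 2*D \<in> reach A D x (Suc T) (2*D)" by (intro reach_step) auto
  then show ?case using Suc.prems by (intro reach_in_A) auto
qed

end

section \<open>Averaging the cost over starting points\<close>

text \<open>A single number that bounds \<open>hole_cost A D x Y\<close> by a multiple of \<open>sqrt Y\<close> for all \<open>Y\<close> at once and that,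
  being linear in \<open>hole_weight\<close>, can be averaged over \<open>x\<close>.\<close>
definition weighted_cost :: "int set \<Rightarrow> int \<Rightarrow> int \<Rightarrow> int \<Rightarrow> real" where
  "weighted_cost A D x Y = (\<Sum>z\<in>{x<..x + Y}. hole_weight A D z / sqrt (real_of_int (z - x)))"

lemma weighted_cost_nonneg: "0 \<le> weighted_cost A D x Y"
  unfolding weighted_cost_def by (intro sum_nonneg divide_nonneg_nonneg hole_weight_nonneg) auto

lemma weighted_cost_mono: "Y \<le> Z \<Longrightarrow> weighted_cost A D x Y \<le> weighted_cost A D x Z"
  unfolding weighted_cost_def by (intro sum_mono2 divide_nonneg_nonneg hole_weight_nonneg) auto

lemma hole_cost_le_weighted_cost: "hole_cost A D x Y \<le> sqrt (real_of_int Y) * weighted_cost A D x Y"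
  unfolding hole_cost_def weighted_cost_def sum_distrib_left
proof (rule sum_mono)
  fix z assume z: "z \<in> {x<..x + Y}"
  then have p: "0 < sqrt (real_of_int (z - x))" by simp
  have "sqrt (real_of_int (z - x)) \<le> sqrt (real_of_int Y)"
  proof (rule real_sqrt_le_mono)
    have "z - x \<le> Y" using z by auto
    then show "real_of_int (z - x) \<le> real_of_int Y" by (simp only: of_int_le_iff)
  qed
  then have "hole_weight A D z * sqrt (real_of_int (z - x)) \<le> hole_weight A D z * sqrt (real_of_int Y)"
    by (intro mult_left_mono hole_weight_nonneg)
  then show "hole_weight A D z \<le> sqrt (real_of_int Y) * (hole_weight A D z / sqrt (real_of_int (z - x)))"
    using p by (simp add: pos_le_divide_eq mult.commute)
qed

lemma sum_inverse_sqrt: "(\<Sum>k<N. 1 / sqrt (real k + 1)) \<le> 2 * sqrt (real N)"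
proof (induction N)
  case (Suc N)
  let ?a = "sqrt (real N)" and ?b = "sqrt (real N + 1)"
  have b: "0 < ?b" by simp
  have sq: "?a * ?a = real N" "?b * ?b = real N + 1" by simp_all
  have "0 \<le> (?b - ?a) * (?b - ?a)" by simp
  then have "2 * (?a * ?b) \<le> 2 * (?b * ?b) - 1" using sq by (simp add: algebra_simps)
  then have "2 * ?a + 1 / ?b \<le> 2 * ?b" using b sq by (simp add: field_simps)
  then show ?case using Suc by (simp add: add.commute)
qed simp

text \<open>The distances from \<open>z\<close> to the points of the interval below it are distinct positive integers.\<close>
lemma sum_inverse_sqrt_interval:
  assumes "a \<le> b"
  shows "(\<Sum>x\<in>{a..<b}. if x < z then 1 / sqrt (real_of_int (z - x)) else 0) \<le> 2 * sqrt (real_of_int (b - a))"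
proof -
  define b' where "b' = max a (min b z)"
  \<comment> \<open>After cutting off the points beyond \<open>z\<close>, count the interval downwards from its last point.\<close>
  define N where "N = nat (b' - a)"
  have b': "a \<le> b'" "b' \<le> b" "b' = a \<or> b' \<le> z" using assms unfolding b'_def by auto
  have "(\<Sum>x\<in>{a..<b}. if x < z then 1 / sqrt (real_of_int (z - x)) else 0)
      = (\<Sum>x\<in>{a..<b'}. 1 / sqrt (real_of_int (z - x)))"
    by (rule sum.mono_neutral_cong_right) (auto simp: b'_def)
  also have "\<dots> = (\<Sum>k<N. 1 / sqrt (real_of_int (z - (b' - 1 - int k))))"
    by (rule sum.reindex_bij_witness[where i="\<lambda>k. b' - 1 - int k" and j="\<lambda>x. nat (b' - 1 - x)"])
       (auto simp: N_def)
  also have "\<dots> \<le> (\<Sum>k<N. 1 / sqrt (real k + 1))"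
  proof (rule sum_mono)
    fix k assume "k \<in> {..<N}"
    then have "b' \<le> z" using b' by (auto simp: N_def)
    then have "real k + 1 \<le> real_of_int (z - (b' - 1 - int k))" by simp
    then show "1 / sqrt (real_of_int (z - (b' - 1 - int k))) \<le> 1 / sqrt (real k + 1)"
      by (intro divide_left_mono real_sqrt_le_mono mult_pos_pos) auto
  qed
  also have "\<dots> \<le> 2 * sqrt (real N)" by (rule sum_inverse_sqrt)
  also have "\<dots> \<le> 2 * sqrt (real_of_int (b - a))"
    using b' by (auto simp: N_def)
  finally show ?thesis .
qed

lemma sum_weighted_cost:
  assumes X: "finite X" "X \<subseteq> {1..N}" "\<And>x. x \<in> X \<Longrightarrow> x + Y \<le> N" and Y: "0 \<le> Y"
  shows "(\<Sum>x\<in>X. weighted_cost A D x Y) \<le> 2 * sqrt (real_of_int Y) * (\<Sum>z\<in>{1..N}. hole_weight A D z)"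
proof -
  let ?f = "\<lambda>x z. if x < z then 1 / sqrt (real_of_int (z - x)) else 0"
  let ?g = "\<lambda>x z. if x < z \<and> z \<le> x + Y then hole_weight A D z * ?f x z else 0"
  have "(\<Sum>x\<in>X. weighted_cost A D x Y) = (\<Sum>x\<in>X. \<Sum>z\<in>{1..N}. ?g x z)"
  proof (rule sum.cong[OF refl])
    fix x assume x: "x \<in> X"
    have "x + Y \<le> N" "1 \<le> x" using X x by auto
    then show "weighted_cost A D x Y = (\<Sum>z\<in>{1..N}. ?g x z)"
      unfolding weighted_cost_def by (intro sum.mono_neutral_cong_left) auto
  qed
  also have "\<dots> = (\<Sum>z\<in>{1..N}. \<Sum>x\<in>X. ?g x z)" by (rule sum.swap)
  also have "\<dots> \<le> (\<Sum>z\<in>{1..N}. hole_weight A D z * (2 * sqrt (real_of_int Y)))"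
  proof (rule sum_mono)
    fix z
    have "(\<Sum>x\<in>X. ?g x z) = (\<Sum>x\<in>X \<inter> {z - Y..<z}. hole_weight A D z * ?f x z)"
      using X(1) by (intro sum.mono_neutral_cong_right) auto
    also have "\<dots> \<le> (\<Sum>x\<in>{z - Y..<z}. hole_weight A D z * ?f x z)"
      by (intro sum_mono2) (auto simp: hole_weight_nonneg)
    also have "\<dots> = hole_weight A D z * (\<Sum>x\<in>{z - Y..<z}. ?f x z)" by (simp only: sum_distrib_left)
    also have "\<dots> \<le> hole_weight A D z * (2 * sqrt (real_of_int (z - (z - Y))))"
      using Y by (intro mult_left_mono sum_inverse_sqrt_interval hole_weight_nonneg) auto
    finally show "(\<Sum>x\<in>X. ?g x z) \<le> hole_weight A D z * (2 * sqrt (real_of_int Y))" by simp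
  qed
  also have "\<dots> = 2 * sqrt (real_of_int Y) * (\<Sum>z\<in>{1..N}. hole_weight A D z)"
    by (simp add: sum_distrib_left mult.commute)
  finally show ?thesis .
qed

text \<open>Each \<open>z\<close> contributes to the scales \<open>4^i \<ge> prev_dist A z\<close> only, and there its contributions form a geometric
  series starting with at most 1.\<close>
lemma sum_hole_weight_over_scales: "(\<Sum>i<N. hole_weight A (4^i) z / 4^i) \<le> 4/3"
proof -
  define l where "l = real (prev_dist A z)"
  have w: "hole_weight A (4^i) z / 4^i = (if l \<le> 4^i then l / 4^i else 0)" for i
  proof -
    have "(int (prev_dist A z) \<le> 4^i) = (l \<le> 4^i)" unfolding l_def
      using of_int_le_iff[of "int (prev_dist A z)" "4^i", where 'a=real] by simp
    then show ?thesis by (simp add: hole_weight_def l_def)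
  qed
  have l0: "0 \<le> l" by (simp add: l_def)
  have "(l \<le> 4^N \<longrightarrow> (\<Sum>i<N. if l \<le> 4^i then l / 4^i else 0) \<le> 4/3 * (1 - l / 4^N)) \<and>
     (\<not> l \<le> 4^N \<longrightarrow> (\<Sum>i<N. if l \<le> 4^i then l / 4^i else 0) = 0)"
  proof (induction N)
    case 0 then show ?case by auto
  next
    case (Suc N)
    have "(4::real)^N \<le> 4^Suc N" by simp
    show ?case
    proof (cases "l \<le> 4^N")
      case True
      then have "l \<le> 4^Suc N" using \<open>(4::real)^N \<le> 4^Suc N\<close> by linarith
      then show ?thesis using Suc True by simp
    next
      case False
      then show ?thesis using Suc by (auto simp: pos_divide_le_eq)
    qed
  qed
  moreover have "4/3 * (1 - l / 4^N) \<le> 4/3" using l0 by simp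
  ultimately show ?thesis unfolding w by (cases "l \<le> 4^N") linarith+
qed

text \<open>Averaging over \<open>x \<in> X\<close>: a position \<open>z\<close> is charged \<open>O(sqrt (K D))\<close> times \<open>hole_weight A D z\<close> in total,
  so the normalized cost of scale \<open>D\<close> sums to \<open>O(K) \<Sum>\<^sub>z hole_weight A D z / D\<close>, and the sum over all scales is \<open>O(K n)\<close>.\<close>
lemma good_origin:
  fixes A :: "int set"
  assumes A: "A \<subseteq> {1..int n}" and K: "1 \<le> K" and n: "1 \<le> n"
    and X: "X \<subseteq> A" "real n \<le> 4 * real (card X)"
    and room: "\<And>x i. x \<in> X \<Longrightarrow> i \<in> I \<Longrightarrow> x + 8 * int K * 4^i \<le> int n"
    and I: "finite I"
  shows "\<exists>x\<in>X. (\<Sum>i\<in>I. weighted_cost A (4^i) x (8 * int K * 4^i) * sqrt (real K * 4^i) / (4^i)\<^sup>2) \<le> 32 * real K"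
proof (rule ccontr)
  assume neg: "\<not> ?thesis"
  let ?F = "\<lambda>x i. weighted_cost A (4^i) x (8 * int K * 4^i) * sqrt (real K * 4^i) / (4^i)\<^sup>2"
  have finX: "finite X" using X A finite_subset[of X "{1..int n}"] by auto
  have X1: "X \<subseteq> {1..int n}" using X A by auto
  have Xne: "X \<noteq> {}" using X n by auto
  obtain N where N: "I \<subseteq> {..<N}" using I finite_nat_set_iff_bounded by (metis lessThan_iff subsetI)
  have each: "(\<Sum>x\<in>X. ?F x i) \<le> 6 * real K * (\<Sum>z\<in>{1..int n}. hole_weight A (4^i) z / 4^i)" if i: "i \<in> I" for i
  proof -
    let ?D = "4^i :: real"
    have D: "0 < ?D" by simp
    have KD: "sqrt (real K * ?D) * sqrt (real K * ?D) = real K * ?D" by simp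
    have "(\<Sum>x\<in>X. ?F x i) = (\<Sum>x\<in>X. weighted_cost A (4^i) x (8 * int K * 4^i)) * (sqrt (real K * ?D) / ?D\<^sup>2)"
      unfolding sum_distrib_right by (intro sum.cong) simp_all
    also have "\<dots> \<le> (2 * sqrt (real_of_int (8 * int K * 4^i)) * (\<Sum>z\<in>{1..int n}. hole_weight A (4^i) z)) * (sqrt (real K * ?D) / ?D\<^sup>2)"
      using room[OF _ i] by (intro mult_right_mono sum_weighted_cost finX X1) auto
    also have "sqrt (real_of_int (8 * int K * 4^i)) = sqrt 8 * sqrt (real K * ?D)"
      by (simp add: real_sqrt_mult)
    also have "(2 * (sqrt 8 * sqrt (real K * ?D)) * (\<Sum>z\<in>{1..int n}. hole_weight A (4^i) z)) * (sqrt (real K * ?D) / ?D\<^sup>2)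
       = 2 * sqrt 8 * (sqrt (real K * ?D) * sqrt (real K * ?D)) / ?D\<^sup>2 * (\<Sum>z\<in>{1..int n}. hole_weight A (4^i) z)"
      by (simp only: times_divide_eq_left times_divide_eq_right mult_ac)
    also have "\<dots> = (2 * sqrt 8) * (real K * ((\<Sum>z\<in>{1..int n}. hole_weight A (4^i) z) / ?D))"
      unfolding KD using D by (simp add: power2_eq_square)
    also have "\<dots> \<le> 6 * (real K * ((\<Sum>z\<in>{1..int n}. hole_weight A (4^i) z) / ?D))"
    proof (rule mult_right_mono)
      have "sqrt 8 \<le> 3" by (rule real_le_lsqrt) auto
      then show "2 * sqrt 8 \<le> (6::real)" by simp
    qed (intro mult_nonneg_nonneg divide_nonneg_nonneg sum_nonneg hole_weight_nonneg, auto)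
    finally show ?thesis by (simp add: sum_divide_distrib)
  qed
  have "32 * real K * real (card X) < (\<Sum>x\<in>X. \<Sum>i\<in>I. ?F x i)"
    using sum_strict_mono[OF finX Xne, of "\<lambda>_. 32 * real K" "\<lambda>x. \<Sum>i\<in>I. ?F x i"] neg
    by (auto simp: not_le mult.commute)
  also have "\<dots> = (\<Sum>i\<in>I. \<Sum>x\<in>X. ?F x i)" by (rule sum.swap)
  also have "\<dots> \<le> (\<Sum>i\<in>I. 6 * real K * (\<Sum>z\<in>{1..int n}. hole_weight A (4^i) z / 4^i))"
    by (intro sum_mono each)
  also have "\<dots> = 6 * real K * (\<Sum>z\<in>{1..int n}. \<Sum>i\<in>I. hole_weight A (4^i) z / 4^i)"
    unfolding sum_distrib_left[symmetric] by (subst sum.swap) simp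
  also have "\<dots> \<le> 6 * real K * (\<Sum>z\<in>{1..int n}. 4/3)"
  proof (intro mult_left_mono sum_mono)
    fix z
    have "(\<Sum>i\<in>I. hole_weight A (4^i) z / 4^i) \<le> (\<Sum>i<N. hole_weight A (4^i) z / 4^i)"
      using N by (intro sum_mono2 divide_nonneg_nonneg hole_weight_nonneg) auto
    then show "(\<Sum>i\<in>I. hole_weight A (4^i) z / 4^i) \<le> 4/3" using sum_hole_weight_over_scales[of A z N] by linarith
  qed auto
  also have "\<dots> = 8 * real K * real n" by simp
  also have "\<dots> \<le> 8 * real K * (4 * real (card X))" using X by (intro mult_left_mono) auto
  finally show False by simp
qed

text \<open>The start may be moved to the right by up to \<open>D\<close>, so that it can be rounded up to a point of \<open>A\<close>: since only
  windows of length \<open>Y \<ge> D\<close> count, this lengthens them by a factor of at most 2.\<close>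
lemma cleanI:
  assumes e: "e \<in> A" "x \<le> e" "e \<le> x + D" and D: "0 < D" and K: "1 \<le> K"
    and W: "weighted_cost A D x (6 * int K * D) * sqrt (real K * real_of_int D) \<le> 7 / 10^7 * (real_of_int D)\<^sup>2"
  shows "clean A D K e"
  unfolding clean_def
proof (intro conjI allI impI e(1))
  fix Y assume Y: "D \<le> Y \<and> Y \<le> 4 * int K * D"
  let ?KD = "real K * real_of_int D"
  have KD: "0 < ?KD" using D K by simp
  have KD': "D \<le> int K * D" using mult_right_mono[of 1 "int K" D] D K by simp
  let ?W = "weighted_cost A D x (6 * int K * D)"
  have "hole_cost A D e Y \<le> hole_cost A D x (Y + D)" using e by (intro hole_cost_subset) auto
  also have "\<dots> \<le> sqrt (real_of_int (Y + D)) * weighted_cost A D x (Y + D)"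
    by (rule hole_cost_le_weighted_cost)
  also have "\<dots> \<le> sqrt (real_of_int (Y + D)) * ?W"
    using Y KD' D by (intro mult_left_mono weighted_cost_mono) (linarith, simp)
  also have "\<dots> \<le> (10/7 * sqrt (real_of_int Y)) * ?W"
  proof (intro mult_right_mono weighted_cost_nonneg)
    have "Y + D \<le> 2 * Y" using Y by linarith
    then have "real_of_int (Y + D) \<le> real_of_int (2 * Y)" by (simp only: of_int_le_iff)
    then have "sqrt (real_of_int (Y + D)) \<le> sqrt (2 * real_of_int Y)" by simp
    also have "\<dots> = sqrt 2 * sqrt (real_of_int Y)" by (rule real_sqrt_mult)
    also have "\<dots> \<le> 10/7 * sqrt (real_of_int Y)"
    proof (rule mult_right_mono)
      show "sqrt 2 \<le> 10/7" by (rule real_le_lsqrt) (auto simp: power2_eq_square)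
    qed (use Y D in auto)
    finally show "sqrt (real_of_int (Y + D)) \<le> 10/7 * sqrt (real_of_int Y)" .
  qed
  also have "\<dots> = 10/7 * (sqrt (real_of_int Y) / sqrt ?KD) * (?W * sqrt ?KD)"
  proof -
    have "10/7 * s * w = 10/7 * (s / r) * (w * r)" if "0 < r" for s w r :: real using that by simp
    from this[of "sqrt ?KD"] KD show ?thesis by simp
  qed
  also have "\<dots> \<le> 10/7 * (sqrt (real_of_int Y) / sqrt ?KD) * (7 / 10^7 * (real_of_int D)\<^sup>2)"
    by (intro mult_left_mono W) (use Y D KD in auto)
  also have "\<dots> = sqrt (real_of_int Y / ?KD) * (real_of_int D)\<^sup>2 / 10^6"
    by (simp add: real_sqrt_divide)
  finally show "hole_cost A D e Y \<le> sqrt (real_of_int Y / ?KD) * (real_of_int D)\<^sup>2 / 10^6" .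
qed

text \<open>Averaging \<open>1 / sqrt (z - x)\<close> over an interval of \<open>x\<close> whose length is comparable to its
  distance from \<open>o'\<close> costs a constant factor against \<open>1 / sqrt (z - o')\<close>: far from the interval the two are
  comparable pointwise, and near it the average is \<open>O(1 / sqrt (b - a))\<close>.\<close>
lemma average_inverse_sqrt:
  assumes q: "0 < b - a" "o' \<le> a" "b - o' \<le> 5 * (b - a)" and z: "o' < z"
  shows "(\<Sum>x\<in>{a..<b}. if x < z then 1 / sqrt (real_of_int (z - x)) else 0)
    \<le> 7 * real_of_int (b - a) / sqrt (real_of_int (z - o'))"
proof (cases "z - o' \<le> 10 * (b - a)")
  case True
  let ?q = "real_of_int (b - a)" and ?w = "real_of_int (z - o')"
  have p: "0 < ?q" "0 < ?w" using q z by auto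
  have "?w \<le> real_of_int (10 * (b - a))" using True by (simp only: of_int_le_iff)
  then have "sqrt ?w \<le> sqrt (10 * ?q)" by simp
  also have "\<dots> = sqrt 10 * sqrt ?q" by (rule real_sqrt_mult)
  also have "\<dots> \<le> 7/2 * sqrt ?q"
  proof (rule mult_right_mono)
    show "sqrt 10 \<le> 7/2" by (rule real_le_lsqrt) (auto simp: power2_eq_square)
  qed (use p in auto)
  finally have "2 * sqrt ?q * sqrt ?w \<le> 2 * sqrt ?q * (7/2 * sqrt ?q)" using p by (intro mult_left_mono) auto
  also have "\<dots> = 7 * ?q" using p by simp
  finally have "2 * sqrt ?q \<le> 7 * ?q / sqrt ?w" using p by (simp add: pos_le_divide_eq)
  then show ?thesis using sum_inverse_sqrt_interval[of a b z] q by simp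
next
  case False
  let ?w = "real_of_int (z - o')"
  have w: "0 < ?w" using z by simp
  have "(if x < z then 1 / sqrt (real_of_int (z - x)) else 0) \<le> 7 / sqrt ?w" if x: "x \<in> {a..<b}" for x
  proof -
    \<comment> \<open>Here even \<open>z - o' \<le> 2 (z - x)\<close>; the square 49 fits the constant 7.\<close>
    have "z - o' \<le> 49 * (z - x)" using False q x by auto
    then have "?w \<le> real_of_int (49 * (z - x))" by (simp only: of_int_le_iff)
    then have "sqrt ?w \<le> sqrt (7\<^sup>2 * real_of_int (z - x))" by simp
    also have "\<dots> = 7 * sqrt (real_of_int (z - x))" by (simp only: real_sqrt_mult real_sqrt_abs abs_numeral)
    finally have "sqrt ?w \<le> 7 * sqrt (real_of_int (z - x))" .
    then show ?thesis using w False q x by (auto simp: field_simps)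
  qed
  then have "(\<Sum>x\<in>{a..<b}. if x < z then 1 / sqrt (real_of_int (z - x)) else 0) \<le> (\<Sum>x\<in>{a..<b}. 7 / sqrt ?w)"
    by (rule sum_mono)
  also have "\<dots> = 7 * real_of_int (b - a) / sqrt ?w" using q by simp
  finally show ?thesis .
qed

lemma exists_cheap_point:
  assumes q: "0 < b - a" "o' \<le> a" "b - o' \<le> 5 * (b - a)" and Y: "b + Y \<le> o' + Z"
  shows "\<exists>x\<in>{a..<b}. weighted_cost A D x Y \<le> 7 * weighted_cost A D o' Z"
proof (rule ccontr)
  assume neg: "\<not> ?thesis"
  let ?f = "\<lambda>x z. if x < z then 1 / sqrt (real_of_int (z - x)) else 0"
  let ?Z = "{o'<..o' + Z}"
  have "real (card {a..<b}) * (7 * weighted_cost A D o' Z) < (\<Sum>x\<in>{a..<b}. weighted_cost A D x Y)"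
    using sum_strict_mono[of "{a..<b}" "\<lambda>_. 7 * weighted_cost A D o' Z" "\<lambda>x. weighted_cost A D x Y"] neg q
    by (auto simp: not_le)
  also have "\<dots> \<le> (\<Sum>x\<in>{a..<b}. \<Sum>z\<in>?Z. hole_weight A D z * ?f x z)"
  proof (rule sum_mono)
    fix x assume x: "x \<in> {a..<b}"
    have "weighted_cost A D x Y = (\<Sum>z\<in>{x<..x + Y}. hole_weight A D z * ?f x z)"
      unfolding weighted_cost_def by (intro sum.cong) auto
    also have "\<dots> \<le> (\<Sum>z\<in>?Z. hole_weight A D z * ?f x z)"
      using x q Y by (intro sum_mono2) (auto simp: hole_weight_nonneg)
    finally show "weighted_cost A D x Y \<le> (\<Sum>z\<in>?Z. hole_weight A D z * ?f x z)" .
  qed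
  also have "\<dots> = (\<Sum>z\<in>?Z. hole_weight A D z * (\<Sum>x\<in>{a..<b}. ?f x z))"
    unfolding sum_distrib_left by (rule sum.swap)
  also have "\<dots> \<le> (\<Sum>z\<in>?Z. hole_weight A D z * (7 * real_of_int (b - a) / sqrt (real_of_int (z - o'))))"
    by (intro sum_mono mult_left_mono average_inverse_sqrt q hole_weight_nonneg) auto
  also have "\<dots> = real (card {a..<b}) * (7 * weighted_cost A D o' Z)"
    using q unfolding weighted_cost_def sum_distrib_left by (intro sum.cong) auto
  finally show False by simp
qed

section \<open>Joining the scales\<close>

text \<open>All that matters for extending a wave: \<open>k\<close> is its number of terms, \<open>y\<close> its last term and \<open>u\<close> a bound for
  its last gap.\<close>
inductive chain :: "int set \<Rightarrow> nat \<Rightarrow> int \<Rightarrow> int \<Rightarrow> bool" for A where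
  single: "y \<in> A \<Longrightarrow> chain A 1 y u"
| extend: "chain A k z g \<Longrightarrow> g \<le> y - z \<Longrightarrow> 0 < y - z \<Longrightarrow> y - z \<le> u \<Longrightarrow> y \<in> A \<Longrightarrow> chain A (Suc k) y u"

lemma chain_mono: "chain A k y u \<Longrightarrow> u \<le> v \<Longrightarrow> chain A k y v"
proof (induction rule: chain.induct)
  case (single y u)
  then show ?case using chain.single by simp
next
  case (extend k z g y u)
  then show ?case using chain.extend[OF extend.hyps(1,2,3) _ extend.hyps(5)] by simp
qed

lemma ascending_wave_snoc:
  assumes "ascending_wave xs" "last xs < y"
    and "2 \<le> length xs \<longrightarrow> xs ! (length xs - 1) - xs ! (length xs - 2) \<le> y - last xs"
  shows "ascending_wave (xs @ [y])"
proof -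
  have ne: "xs \<noteq> []" and so: "sorted_wrt (<) xs"
    and conv: "\<And>t. 1 \<le> t \<Longrightarrow> t + 1 < length xs \<Longrightarrow> xs ! t - xs ! (t - 1) \<le> xs ! (t + 1) - xs ! t"
    using assms(1) by (auto simp: ascending_wave_def)
  have la: "last xs = xs ! (length xs - 1)" using ne by (rule last_conv_nth)
  have "x \<le> last xs" if xin: "x \<in> set xs" for x
  proof -
    obtain i where i: "i < length xs" "x = xs ! i" using xin by (auto simp: in_set_conv_nth)
    show ?thesis
    proof (cases "i = length xs - 1")
      case False
      then have "xs ! i < xs ! (length xs - 1)" using i by (intro sorted_wrt_nth_less[OF so]) auto
      then show ?thesis using i la by simp
    qed (use i la in simp)
  qed
  then have so': "sorted_wrt (<) (xs @ [y])" using so assms(2) by (force simp: sorted_wrt_append)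
  have "(xs @ [y]) ! t - (xs @ [y]) ! (t - 1) \<le> (xs @ [y]) ! (t + 1) - (xs @ [y]) ! t"
    if t: "1 \<le> t" "t + 1 < length (xs @ [y])" for t
  proof (cases "t + 1 < length xs")
    case True
    moreover have "t < length xs" "t - 1 < length xs" using True by auto
    ultimately show ?thesis using conv[OF t(1) True] by (simp only: nth_append if_True)
  next
    case False
    then have "t = length xs - 1" "2 \<le> length xs" using t by auto
    then show ?thesis using assms(3) la t by (auto simp: nth_append numeral_2_eq_2)
  qed
  then show ?thesis using so' by (simp add: ascending_wave_def)
qed

lemma chain_imp_wave:
  "chain A k y u \<Longrightarrow> \<exists>xs. ascending_wave xs \<and> set xs \<subseteq> A \<and> length xs = k \<and> last xs = y \<and>
     (2 \<le> length xs \<longrightarrow> xs ! (length xs - 1) - xs ! (length xs - 2) \<le> u)"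
proof (induction rule: chain.induct)
  case (single y u)
  then show ?case by (intro exI[of _ "[y]"]) (auto simp: ascending_wave_def)
next
  case (extend k z g y u)
  then obtain xs where xs: "ascending_wave xs" "set xs \<subseteq> A" "length xs = k" "last xs = z"
     "2 \<le> length xs \<longrightarrow> xs ! (length xs - 1) - xs ! (length xs - 2) \<le> g" by blast
  have ne: "xs \<noteq> []" using xs(1) by (simp add: ascending_wave_def)
  have la: "z = xs ! (length xs - 1)" using ne xs(4) last_conv_nth by metis
  have "ascending_wave (xs @ [y])"
    by (rule ascending_wave_snoc) (use xs extend in auto)
  moreover have "(xs @ [y]) ! (length (xs @ [y]) - 1) - (xs @ [y]) ! (length (xs @ [y]) - 2) \<le> u"
    using ne la extend by (auto simp: nth_append numeral_2_eq_2)
  ultimately show ?case using xs extend by (intro exI[of _ "xs @ [y]"]) auto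
qed

lemma ascending_wave_take:
  assumes "ascending_wave xs" "1 \<le> k" "k \<le> length xs"
  shows "ascending_wave (take k xs)"
  using assms unfolding ascending_wave_def by (auto intro: sorted_wrt_take)

lemma chain_imp_has_wave:
  assumes "chain A k y u" "1 \<le> k'" "k' \<le> k"
  shows "has_wave A k'"
proof -
  obtain xs where xs: "ascending_wave xs" "set xs \<subseteq> A" "length xs = k"
    using chain_imp_wave[OF assms(1)] by blast
  have "ascending_wave (take k' xs)" using ascending_wave_take[OF xs(1)] assms xs(3) by simp
  moreover have "set (take k' xs) \<subseteq> A" using xs(2) set_take_subset[of k' xs] by blast
  ultimately show ?thesis unfolding has_wave_def using xs(3) assms by (intro exI[of _ "take k' xs"]) auto
qed

lemma chain_reach:
  assumes "chain A k x D" "0 < D" "y \<in> A" "y \<in> reach A D x t u"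
  shows "chain A (k + t) y u"
  using assms(3,4)
proof (induction t arbitrary: y u)
  case 0
  then show ?case using assms(1) chain_mono by (auto split: if_splits)
next
  case (Suc t)
  from Suc.prems(2) obtain g where g: "D \<le> g" "g \<le> u" "y - g \<in> A" "y - g \<in> reach A D x t g"
    by (blast elim: reach_SucE)
  have "chain A (Suc (k + t)) y u"
    by (rule chain.extend[OF Suc.IH[OF g(3,4)]]) (use g assms(2) Suc.prems in auto)
  then show ?case by simp
qed

text \<open>A wave that runs past \<open>q\<close> has a last term \<open>p \<le> q\<close>, and its next gap, which is at most \<open>u\<close>, carries it
  beyond \<open>q\<close>.\<close>
lemma reach_passes:
  assumes "x \<le> q" "q < y" "y \<in> reach A D x t u"
  shows "\<exists>s<t. \<exists>p\<in>A. p \<in> reach A D x s u \<and> p \<le> q \<and> q < p + u"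
  using assms(2,3)
proof (induction t arbitrary: y u)
  case 0
  then show ?case using assms(1) by (auto split: if_splits)
next
  case (Suc t)
  from Suc.prems(2) obtain g where g: "D \<le> g" "g \<le> u" "y - g \<in> A" "y - g \<in> reach A D x t g"
    by (blast elim: reach_SucE)
  show ?case
  proof (cases "y - g \<le> q")
    case True
    have "y - g \<in> reach A D x t u" using reach_mono[OF g(4,2)] .
    then show ?thesis using True g Suc.prems by (intro exI[of _ t] conjI bexI[of _ "y - g"]) auto
  next
    case False
    then obtain s p where sp: "s < t" "p \<in> A" "p \<in> reach A D x s g" "p \<le> q" "q < p + g"
      using Suc.IH[OF _ g(4)] by auto
    have "p \<in> reach A D x s u" using reach_mono[OF sp(3) g(2)] .
    then show ?thesis using sp g by (intro exI[of _ s] conjI bexI[of _ p]) auto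
  qed
qed

text \<open>A wave with gaps in \<open>[D, 2D]\<close> runs from \<open>x\<close> to \<open>x + 4 q\<close> or further, where \<open>q = K D\<close>. Among the points of
  \<open>[x + 2q, x + 3q)\<close> there is one with small weighted cost at scale \<open>D'\<close>, and the next point \<open>x'\<close> of
  \<open>A\<close> is clean at that scale. Leaving the wave at its last term up to \<open>x' - 2D\<close> gives a
  final gap in \<open>[2D, 4D]\<close>, which continues the wave at \<open>D\<close> and is admissible before a stage at
  scale \<open>D' \<ge> 4D\<close>. At least \<open>K\<close> terms have been gained, since \<open>x'\<close> is about \<open>2q\<close> or more away and
  the gaps used are at most \<open>2D\<close>.\<close>
lemma next_stage:
  fixes x x0 D D' m :: int
  assumes cl: "clean A D (4 * K) x" and ch: "chain A k x D" and D8: "D = 8 * m"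
    and DK: "800 * int K \<le> D" and K: "1 \<le> K" and x0: "x0 \<le> x" "3 * (x - x0) \<le> 4 * int K * D"
    and D': "4 * D \<le> D'"
    and W: "weighted_cost A D' x0 (8 * int (4 * K) * D') * sqrt (real (4 * K) * real_of_int D') \<le> (real_of_int D')\<^sup>2 / 10^7"
  shows "\<exists>x' k'. clean A D' (4 * K) x' \<and> chain A k' x' D' \<and> k + K \<le> k' \<and> x0 \<le> x' \<and> 3 * (x' - x0) \<le> 4 * int K * D'"
proof -
  interpret clean_start A D m "4 * K" x
    by unfold_locales (use cl D8 DK K in auto)
  define q where "q = int K * D"
  have qD: "D \<le> q" unfolding q_def using mult_right_mono[of 1 "int K" D] Dpos K by simp
  have qD': "4 * q \<le> int K * D'" unfolding q_def using mult_left_mono[OF D', of "int K"] by simp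
  have D'q: "D' \<le> int K * D'" using mult_right_mono[of 1 "int K" D'] D' Dpos K by simp
  have x0q: "3 * x \<le> 3 * x0 + 4 * q" using x0 unfolding q_def by simp
  obtain e where e: "e \<in> A" "e \<in> reach A D x (4 * K) (2 * D)" using reach_alive[of "4 * K"] by auto
  have ex: "x + 4 * q \<le> e" using reach_bounds[OF e(2)] unfolding q_def by simp
  have "\<exists>w\<in>{x + 2 * q..<x + 3 * q}. weighted_cost A D' w (6 * int (4 * K) * D')
      \<le> 7 * weighted_cost A D' x0 (8 * int (4 * K) * D')"
  proof (rule exists_cheap_point)
    define P where "P = int K * D'"
    have e: "6 * int (4 * K) * D' = 24 * P" "8 * int (4 * K) * D' = 32 * P" by (simp_all add: P_def)
    show "x + 3 * q + 6 * int (4 * K) * D' \<le> x0 + 8 * int (4 * K) * D'"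
      unfolding e using x0q qD qD'[folded P_def] Dpos by linarith
  qed (use x0 x0q qD Dpos in auto)
  then obtain w where w: "x + 2 * q \<le> w" "w < x + 3 * q"
    "weighted_cost A D' w (6 * int (4 * K) * D') \<le> 7 * weighted_cost A D' x0 (8 * int (4 * K) * D')" by auto
  define x' where "x' = w + int (next_dist A w)"
  have "w + 4 * m \<le> x + 16 * q" using w(2) qD D8 Dpos by linarith
  then have "w + 4 * m \<le> x + 4 * int (4 * K) * D" unfolding q_def by simp
  moreover have "x \<le> w" using w(1) qD Dpos by linarith
  ultimately have n: "int (next_dist A w) < 4 * m" "x' \<in> A"
    using next_dist_small_here[of w] unfolding x'_def by auto
  have x'w: "w \<le> x'" "2 * x' \<le> 2 * w + D" unfolding x'_def using n(1) D8 by auto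
  have "weighted_cost A D' w (6 * int (4 * K) * D') * sqrt (real (4 * K) * real_of_int D')
      \<le> 7 * weighted_cost A D' x0 (8 * int (4 * K) * D') * sqrt (real (4 * K) * real_of_int D')"
    using w(3) D' Dpos by (intro mult_right_mono) auto
  also have "\<dots> = 7 * (weighted_cost A D' x0 (8 * int (4 * K) * D') * sqrt (real (4 * K) * real_of_int D'))"
    by (rule mult.assoc)
  also have "\<dots> \<le> 7 * ((real_of_int D')\<^sup>2 / 10^7)" using W by (rule mult_left_mono) simp
  also have "\<dots> = 7 / 10^7 * (real_of_int D')\<^sup>2" by simp
  finally have W': "weighted_cost A D' w (6 * int (4 * K) * D') * sqrt (real (4 * K) * real_of_int D')
      \<le> 7 / 10^7 * (real_of_int D')\<^sup>2" .
  have cl': "clean A D' (4 * K) x'"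
    by (rule cleanI[OF n(2) x'w(1) _ _ _ W']) (use x'w D' Dpos K in auto)
  have "x \<le> x' - 2 * D" "x' - 2 * D < e" using x'w w qD ex Dpos by linarith+
  from reach_passes[OF this e(2)] obtain s p where sp: "p \<in> A" "p \<in> reach A D x s (2 * D)"
    "p \<le> x' - 2 * D" "x' - 2 * D < p + 2 * D" by blast
  have "chain A (k + s) p (2 * D)" by (rule chain_reach[OF ch Dpos sp(1,2)])
  then have ch': "chain A (Suc (k + s)) x' D'"
    by (rule chain.extend) (use sp n D' Dpos in auto)
  have "p \<le> x + int s * (2 * D)" using reach_bounds[OF sp(2)] by simp
  then have "2 * q - 4 * D < int s * (2 * D)" using sp w x'w by linarith
  then have "(int K - 2) * D < int s * D" unfolding q_def by (simp add: algebra_simps)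
  then have "int K - 2 < int s" using Dpos by simp
  then have "k + K \<le> Suc (k + s)" by simp
  moreover have "3 * (x' - x0) \<le> 4 * int K * D'"
  proof -
    have "3 * x' \<le> 3 * x0 + 16 * q" using x0q w x'w qD Dpos by linarith
    then show ?thesis using qD' by simp
  qed
  moreover have "x0 \<le> x'" using x0 w x'w qD Dpos by linarith
  ultimately show ?thesis using cl' ch' by blast
qed

text \<open>Bad scales are skipped altogether: from a good scale the wave passes directly to the next good one. The
  invariant \<open>3 (x - x0) \<le> 4 K 4^j\<close> keeps the cost as seen from \<open>x0\<close> relevant
  for the stages that start at \<open>x\<close>; it is preserved because scales grow by a factor of at
  least 4 while a stage adds at most \<open>4 K D\<close>.\<close>
lemma chain_through_good_scales:
  assumes x0: "x0 \<in> A" and K: "1 \<le> K" and G: "finite G" "\<And>i. i \<in> G \<Longrightarrow> 2 \<le> i \<and> 800 * int K \<le> 4^i"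
    and W: "\<And>i. i \<in> G \<Longrightarrow> weighted_cost A (4^i) x0 (8 * int (4 * K) * 4^i) * sqrt (real (4 * K) * 4^i) \<le> (4^i)\<^sup>2 / 10^7"
    and j: "j \<in> G"
  shows "\<exists>x k. clean A (4^j) (4 * K) x \<and> chain A k x (4^j) \<and> 1 + K * card {i \<in> G. i < j} \<le> k \<and> x0 \<le> x \<and> 3 * (x - x0) \<le> 4 * int K * 4^j"
  using j
proof (induction j rule: less_induct)
  case (less j)
  have Wj: "weighted_cost A (4^j) x0 (8 * int (4 * K) * 4^j) * sqrt (real (4 * K) * real_of_int (4^j)) \<le> (real_of_int (4^j))\<^sup>2 / 10^7"
    using W[OF less.prems] by simp
  show ?case
  proof (cases "{i \<in> G. i < j} = {}")
    case True
    have "weighted_cost A (4^j) x0 (6 * int (4 * K) * 4^j) * sqrt (real (4 * K) * real_of_int (4^j))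
        \<le> weighted_cost A (4^j) x0 (8 * int (4 * K) * 4^j) * sqrt (real (4 * K) * real_of_int (4^j))"
      by (intro mult_right_mono weighted_cost_mono) auto
    also have "\<dots> \<le> (real_of_int (4^j))\<^sup>2 / 10^7" by (rule Wj)
    also have "\<dots> \<le> 7 / 10^7 * (real_of_int (4^j))\<^sup>2" by simp
    finally have "clean A (4^j) (4 * K) x0" by (intro cleanI[OF x0 order_refl]) (use K in auto)
    moreover have "chain A 1 x0 (4^j)" using x0 by (rule chain.single)
    ultimately show ?thesis unfolding True by (intro exI[of _ x0] exI[of _ 1]) auto
  next
    case False
    define i where "i = Max {i \<in> G. i < j}"
    have fin: "finite {i \<in> G. i < j}" using G by simp
    have i: "i \<in> G" "i < j" using Max_in[OF fin False] unfolding i_def by auto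
    have set: "{i \<in> G. i < j} = insert i {i' \<in> G. i' < i}"
      using i Max_ge[OF fin] unfolding i_def[symmetric] by force
    have card: "card {i \<in> G. i < j} = Suc (card {i' \<in> G. i' < i})"
      unfolding set using G by simp
    from less.IH[OF i(2,1)] obtain x k where xk: "clean A (4^i) (4 * K) x" "chain A k x (4^i)"
      "1 + K * card {i' \<in> G. i' < i} \<le> k" "x0 \<le> x" "3 * (x - x0) \<le> 4 * int K * 4^i" by blast
    have "(4::int)^(2 + (i - 2)) = 4^2 * 4^(i - 2)" by (rule power_add)
    moreover have "2 \<le> i" using G(2)[OF i(1)] by blast
    then have "2 + (i - 2) = i" by simp
    ultimately have "(4::int)^i = 4^2 * 4^(i - 2)" by (simp only:)
    then have D8: "(4::int)^i = 8 * (2 * 4^(i - 2))" by simp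
    have "(4::int)^(Suc i) \<le> 4^j" using i by (intro power_increasing) auto
    then have D': "4 * (4::int)^i \<le> 4^j" by simp
    from next_stage[OF xk(1,2) D8 _ K xk(4,5) D' Wj] G(2)[OF i(1)]
    obtain x' k' where "clean A (4^j) (4 * K) x'" "chain A k' x' (4^j)" "k + K \<le> k'" "x0 \<le> x'"
      "3 * (x' - x0) \<le> 4 * int K * 4^j" by blast
    moreover have "1 + K * card {i \<in> G. i < j} \<le> k'" using \<open>k + K \<le> k'\<close> xk(3) unfolding card by simp
    ultimately show ?thesis by blast
  qed
qed

text \<open>The scales are \<open>4^m, \<dots>, 4^(2m-1)\<close>: large enough for discretization errors to be negligible, and small enough
  for all windows to fit into \<open>[n]\<close> when the starting point avoids the last quarter. By
  \<open>good_origin\<close> at least \<open>0.68 m\<close> of the \<open>m\<close> scales are good for some starting point.\<close>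
lemma long_wave:
  fixes A :: "int set"
  assumes A: "A \<subseteq> {1..int n}" "real n / 2 \<le> real (card A)"
    and m: "6 \<le> m" "4^(3 * m) \<le> n" and K: "1 \<le> K" "4 * 10^9 * K \<le> m"
  shows "has_wave A (K * (m div 2))"
proof -
  let ?I = "{m..<2 * m}"
  define L where "L = 8 * int K * 4^(2 * m)"
  define X where "X = {x \<in> A. x + L \<le> int n}"
  have K800: "800 * K \<le> m" using K(2) by simp
  have m4: "m \<le> 4^m"
  proof -
    have "m < 2^m" by (rule less_exp)
    also have "2^m \<le> (4::nat)^m" by (rule power_mono) auto
    finally show ?thesis by simp
  qed
  have finA: "finite A" using A finite_subset by auto
  have "4 * L \<le> int n"
  proof -
    have "32 * K \<le> 4^m" using K800 m4 by linarith
    then have "32 * K * 4^(2*m) \<le> 4^m * 4^(2*m)" by (intro mult_right_mono) auto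
    also have "\<dots> = 4^(3*m)" by (simp add: power_add[symmetric])
    also have "\<dots> \<le> n" by (rule m)
    finally have "int (32 * K * 4^(2*m)) \<le> int n" by (simp only: of_nat_le_iff)
    then show ?thesis unfolding L_def by simp
  qed
  note L4 = this
  have L0: "0 \<le> L" unfolding L_def by simp
  have "A - X \<subseteq> {int n - L<..int n}" using A by (auto simp: X_def)
  then have "card (A - X) \<le> card {int n - L<..int n}" by (intro card_mono) auto
  then have "int (card (A - X)) \<le> L" using L0 by simp
  moreover have "card A = card X + card (A - X)"
    using finA by (subst card_Un_disjoint[symmetric]) (auto simp: X_def intro: arg_cong[where f=card])
  ultimately have "int (card A) \<le> int (card X) + L" by simp
  then have "real_of_int (int (card A)) \<le> real_of_int (int (card X) + L)" by (simp only: of_int_le_iff)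
  moreover have "real_of_int (4 * L) \<le> real_of_int (int n)" using L4 by (simp only: of_int_le_iff)
  ultimately have cX: "real n \<le> 4 * real (card X)" using A by simp
  have n1: "1 \<le> n" using m(2) by (metis le_trans one_le_numeral one_le_power)
  have "\<exists>x\<in>X. (\<Sum>i\<in>?I. weighted_cost A (4^i) x (8 * int (4 * K) * 4^i) * sqrt (real (4 * K) * 4^i) / (4^i)\<^sup>2) \<le> 32 * real (4 * K)"
  proof (rule good_origin[OF A(1) _ n1 _ cX])
    fix x i assume xi: "x \<in> X" "i \<in> ?I"
    have "(4::int)^(Suc i) \<le> 4^(2*m)" using xi by (intro power_increasing) auto
    then have "8 * int K * (4 * 4^i) \<le> L" unfolding L_def by (intro mult_left_mono) auto
    then show "x + 8 * int (4 * K) * 4^i \<le> int n" using xi by (simp add: X_def)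
  qed (use K in \<open>auto simp: X_def\<close>)
  then obtain x0 where x0: "x0 \<in> X"
    "(\<Sum>i\<in>?I. weighted_cost A (4^i) x0 (8 * int (4 * K) * 4^i) * sqrt (real (4 * K) * 4^i) / (4^i)\<^sup>2) \<le> 32 * real (4 * K)" by blast
  let ?F = "\<lambda>i. weighted_cost A (4^i) x0 (8 * int (4 * K) * 4^i) * sqrt (real (4 * K) * 4^i) / (4^i)\<^sup>2"
  \<comment> \<open>The good scales; by Markov's inequality all but \<open>1.28 \<sqdot> 10^9 K\<close> scales are good.\<close>
  define G where "G = {i \<in> ?I. ?F i \<le> 1 / 10^7}"
  have F0: "0 \<le> ?F i" for i
    by (intro divide_nonneg_nonneg mult_nonneg_nonneg weighted_cost_nonneg) auto
  have "real (card (?I - G)) * (1 / 10^7) \<le> (\<Sum>i\<in>?I - G. ?F i)"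
    by (rule sum_bounded_below) (auto simp: G_def)
  also have "\<dots> \<le> (\<Sum>i\<in>?I. ?F i)" using F0 by (intro sum_mono2) auto
  also have "\<dots> \<le> 128 * real K" using x0(2) by simp
  finally have bad: "real (card (?I - G)) \<le> 1280000000 * real K" by simp
  have "real (4 * 10^9 * K) \<le> real m" using K(2) by (simp only: of_nat_le_iff)
  then have "real (card (?I - G)) \<le> 32/100 * real m" using bad by simp
  moreover have "card (?I - G) = m - card G" "card G \<le> m"
  proof -
    have GI: "G \<subseteq> ?I" "finite G" by (auto simp: G_def)
    show "card (?I - G) = m - card G" using card_Diff_subset[OF GI(2,1)] by simp
    show "card G \<le> m" using card_mono[OF _ GI(1)] by simp
  qed
  ultimately have cG: "68/100 * real m \<le> real (card G)" by (simp add: of_nat_diff)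
  have cG2: "m div 2 + 1 \<le> card G"
  proof -
    have "2 * (m div 2) \<le> m" by simp
    then have "real (2 * (m div 2)) \<le> real m" by (simp only: of_nat_le_iff)
    then have "real (m div 2 + 1) \<le> 68/100 * real m" using m by simp
    then have "real (m div 2 + 1) \<le> real (card G)" using cG by linarith
    then show ?thesis by (simp only: of_nat_le_iff)
  qed
  have finG: "finite G" by (simp add: G_def)
  have Gne: "G \<noteq> {}" using cG2 by auto
  define j where "j = Max G"
  have j: "j \<in> G" unfolding j_def using finG Gne by (rule Max_in)
  have "\<exists>x k. clean A (4^j) (4 * K) x \<and> chain A k x (4^j) \<and> 1 + K * card {i \<in> G. i < j} \<le> k \<and> x0 \<le> x \<and> 3 * (x - x0) \<le> 4 * int K * 4^j"
  proof (rule chain_through_good_scales[OF _ K(1) finG _ _ j])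
    show "x0 \<in> A" using x0 by (simp add: X_def)
    fix i assume i: "i \<in> G"
    then have im: "m \<le> i" by (simp add: G_def)
    have "800 * K \<le> 4^m" using K800 m4 by linarith
    also have "\<dots> \<le> 4^i" using im by (intro power_increasing) auto
    finally have "int (800 * K) \<le> int (4^i)" by (simp only: of_nat_le_iff)
    then show "2 \<le> i \<and> 800 * int K \<le> 4^i" using im m by simp
    have "?F i \<le> 1 / 10^7" using i by (simp add: G_def)
    then show "weighted_cost A (4^i) x0 (8 * int (4 * K) * 4^i) * sqrt (real (4 * K) * 4^i) \<le> (4^i)\<^sup>2 / 10^7"
      by (simp add: pos_divide_le_eq)
  qed
  then obtain x k where ck: "chain A k x (4^j)" "1 + K * card {i \<in> G. i < j} \<le> k" by blast
  have Gj: "G = insert j {i \<in> G. i < j}" using j Max_ge[OF finG] unfolding j_def[symmetric] by force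
  have "card (insert j {i \<in> G. i < j}) = Suc (card {i \<in> G. i < j})" using finG by simp
  then have "card G = Suc (card {i \<in> G. i < j})" by (simp only: Gj[symmetric])
  then have "m div 2 \<le> card {i \<in> G. i < j}" using cG2 by simp
  then have "K * (m div 2) \<le> K * card {i \<in> G. i < j}" by (rule mult_le_mono2)
  then have "K * (m div 2) \<le> k" using ck(2) by linarith
  moreover have "1 * 1 \<le> K * (m div 2)" using K m by (intro mult_le_mono) auto
  then have "1 \<le> K * (m div 2)" by simp
  ultimately show ?thesis using chain_imp_has_wave[OF ck(1)] by blast
qed

lemma wave_g_lower:
  assumes n: "exp (10^12) \<le> real n"
  shows "1 / 10^13 * (ln (real n))\<^sup>2 \<le> real (wave_g n)"
proof -
  have n0: "0 < real n" using n exp_gt_zero[of "10^12::real"] by linarith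
  define l where "l = ln (real n)"
  have l: "10^12 \<le> l" unfolding l_def using n n0 by (metis ln_exp ln_le_cancel_iff exp_gt_zero)
  have ln4: "0 < ln (4::real)" "ln (4::real) \<le> 3"
    using ln_le_minus_one[of "4::real"] by auto
  \<comment> \<open>Thus \<open>4^(3 m) \<le> n\<close>, a factor of about \<open>4^m\<close> above the largest scale; \<open>K\<close> is a small multiple of the number \<open>m\<close> of scales.\<close>
  define m where "m = nat \<lfloor>l / (3 * ln 4)\<rfloor>"
  define K where "K = m div (4 * 10^9)"
  have q: "l / 9 \<le> l / (3 * ln 4)" using l ln4 by (intro divide_left_mono) auto
  have l0: "0 \<le> l" using l by (rule order_trans[rotated]) simp
  have q0: "0 \<le> l / (3 * ln 4)" using l0 ln4 by simp
  have m1: "real m \<le> l / (3 * ln 4)" "l / (3 * ln 4) - 1 \<le> real m" unfolding m_def using q0 by linarith+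
  have l100: "100 \<le> l" using l by (rule order_trans[rotated]) simp
  have m10: "l / 10 \<le> real m"
  proof -
    have "l / 10 \<le> l / 9 - 1" using l100 by linarith
    also have "\<dots> \<le> l / (3 * ln 4) - 1" using q by (rule diff_right_mono)
    finally show ?thesis using m1(2) by (rule order_trans)
  qed
  have "4^(3 * m) \<le> n"
  proof -
    have "exp (ln 4 * real (3 * m)) = exp (ln 4) ^ (3 * m)" by (rule exp_of_nat2_mult)
    then have "real (4^(3*m)) = exp (ln 4 * real (3 * m))" by simp
    also have "\<dots> \<le> exp l"
    proof -
      have "ln 4 * real (3 * m) \<le> l" using m1(1) ln4 by (simp add: pos_le_divide_eq algebra_simps)
      then show ?thesis by simp
    qed
    also have "\<dots> = real n" unfolding l_def using n0 by simp
    finally show ?thesis by (simp only: of_nat_le_iff)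
  qed
  note m4 = this
  have mbig: "10^11 \<le> real m" using m10 l by simp
  have K1: "4 * 10^9 * K \<le> m" unfolding K_def by (rule times_div_less_eq_dividend)
  have "m < 4 * 10^9 * (K + 1)" unfolding K_def using dividend_less_times_div[of "4 * 10^9" m] by simp
  then have "real m < real (4 * 10^9 * (K + 1))" by (simp only: of_nat_less_iff)
  then have K2: "real m / (8 * 10^9) \<le> real K" using mbig by simp
  then have "0 < real K" using mbig by simp
  then have K3: "1 \<le> K" by simp
  have m6: "6 \<le> m" using mbig by simp
  have n1: "1 \<le> n" using n0 by simp
  have "K * (m div 2) \<le> wave_g n"
    by (rule wave_g_is_greatest(2)[OF n1]) (use long_wave[OF _ _ m6 m4 K3 K1] in auto)
  then have "real (K * (m div 2)) \<le> real (wave_g n)" by (simp only: of_nat_le_iff)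
  moreover have "1 / 10^13 * l\<^sup>2 \<le> real (K * (m div 2))"
  proof -
    have "m \<le> 2 * (m div 2) + 1" by presburger
    then have "real m \<le> 2 * real (m div 2) + 1" by linarith
    then have h: "real m / 4 \<le> real (m div 2)" using mbig by simp
    have "1 / 10^13 * l\<^sup>2 \<le> (l / 10 / (8 * 10^9)) * (l / 10 / 4)" by (simp add: power2_eq_square)
    also have "\<dots> \<le> (real m / (8 * 10^9)) * (real m / 4)" using m10 l by (intro mult_mono divide_right_mono) auto
    also have "\<dots> \<le> real K * real (m div 2)" using K2 h by (intro mult_mono) auto
    finally show ?thesis by simp
  qed
  ultimately show ?thesis unfolding l_def by linarith
qed

section \<open>The order of magnitude\<close>

theorem corollary4p4:
  shows "\<exists>c C :: real. \<exists>n0 :: nat. c > 0 \<and> C > 0 \<and>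
    (\<forall>n \<ge> n0. c * (ln (real n))\<^sup>2 \<le> real (wave_g n) \<and> real (wave_g n) \<le> C * (ln (real n))\<^sup>2)"
proof (intro exI conjI allI impI)
  show "0 < 1 / (10::real)^13" "0 < 65 / (ln (2::real))\<^sup>2" by simp_all
  fix n assume n: "nat \<lceil>exp (10^12 :: real)\<rceil> + 2 \<le> n"
  have "exp (10^12) \<le> real (nat \<lceil>exp (10^12 :: real)\<rceil>)" by (rule real_nat_ceiling_ge)
  also have "\<dots> \<le> real n" using n by linarith
  finally show "1 / 10^13 * (ln (real n))\<^sup>2 \<le> real (wave_g n)" by (rule wave_g_lower)
  show "real (wave_g n) \<le> 65 / (ln 2)\<^sup>2 * (ln (real n))\<^sup>2" using n by (intro wave_g_upper) linarith
qed

end
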